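(* Let $X,U$ be Banach spaces and $\mathcal{U}=PC(\mathbb{R}_+,U)$. Let $\{A(t)\}_{t\ge0}$ generate a strongly continuous evolution family $\{W(t,s)\}_{t\ge s\ge0}$. Let $B\in C(\mathbb{R}_+,L(U,X))$ with $\sup_t\|B(t)\|<\infty$, and consider $$\dot x=A(t)x+B(t)u+\psi(t,x,u),\quad x(t_0)=x_0. \tag{N}$$ Assume: - $\Psi(t,x,u)=B(t)u+\psi(t,x,u)$ satisfies $(\mathcal{H}_1)$; - there exist $\gamma>0$ and $\delta\in\mathcal{K}$ such that $\|\psi(t,x,v)\|_X\le\gamma\|x\|_X\delta(\|v\|_U)$ for all $t\ge0$, $x\in X$ and $v\in U$; - $\{W(t,s)\}$ is uniformly exponentially stable; - there exist $M,\lambda>0$ with $\|W(t,s)x\|_X\ge Me^{-\lambda(t-s)}\|x\|_X$ for all $x\in X$ and $t\ge s\ge0$. Let $V(t,x)=\int_t^\infty\|W(\tau,t)x\|_X^2d\tau$. Then $Z(t,x)=\ln(1+V(t,x))$ is a coercive iISS Lyapunov function for (N), and (N) is iISS.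
   Context: A strongly continuous evolution family generated by $\{A(t)\}$ satisfies: - $W(s,s)=I$ and $W(t,s)=W(t,r)W(r,s)$; - strong continuity in $(t,s)$; - for $v\in D(A(s))$: $\partial_tW(t,s)v=A(t)W(t,s)v$ and $\partial_sW(t,s)v=-W(t,s)A(s)v$. Uniform exponential stability means $\|W(t,s)\|\le ke^{-w(t-s)}$ for some $k,w>0$. $PC(\mathbb{R}_+,U)$ consists of bounded, right-continuous, piecewise continuous functions. $(\mathcal{H}_1)$: $\Psi$ is jointly continuous in $(t,u)$ and Lipschitz in $x$ on bounded sets (uniformly on bounded time intervals). Solutions are the mild solutions $\phi$ of $x(t)=W(t,t_0)x_0+\int_{t_0}^tW(t,s)\Psi(s,x(s),u(s))ds$. Lie derivative: $\dot Z_u(t,x)=\limsup_{h\to0^+}\frac1h(Z(t+h,\phi(t+h,t,x,u))-Z(t,x))$. Coercive iISS Lyapunov function. A continuous $Z$ with $Z(t,0)=0$, $\alpha_1(\|x\|)\le Z(t,x)\le\alpha_2(\|x\|)$ for some $\alpha_1,\alpha_2\in\mathcal{K}_\infty$, and $\dot Z_u(t,x)\le-\eta(\|x\|)+\chi(\|u(t)\|_U)$ for all $t,x,u$, with $\eta$ continuous positive definite and $\chi\in\mathcal{K}$. iISS: the system is forward complete and there exist $\alpha\in\mathcal{K}_\infty$, $\mu\in\mathcal{K}$ and $\beta\in\mathcal{KL}$ with $$\|\phi(t,t_0,x_0,u)\|\le\beta(\|x_0\|,t-t_0)+\alpha\Big(\int_{t_0}^t\mu(\|u(s)\|_U)ds\Big)\quad\text{for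 all } t\ge t_0\ge0.$$ *)

theory Defs
  imports "HOL-Analysis.Analysis"
begin

definition class_K :: "(real \<Rightarrow> real) \<Rightarrow> bool" where
  "class_K \<alpha> \<longleftrightarrow> continuous_on {0..} \<alpha> \<and> \<alpha> 0 = 0 \<and> strict_mono_on {0..} \<alpha>"

definition class_Kinf :: "(real \<Rightarrow> real) \<Rightarrow> bool" where
  "class_Kinf \<alpha> \<longleftrightarrow> class_K \<alpha> \<and> filterlim \<alpha> at_top at_top"

definition class_KL :: "(real \<Rightarrow> real \<Rightarrow> real) \<Rightarrow> bool" where
  "class_KL \<beta> \<longleftrightarrow> continuous_on ({0..} \<times> {0..}) (\<lambda>(r,t). \<beta> r t)
     \<and> (\<forall>t\<ge>0. class_K (\<lambda>r. \<beta> r t))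
     \<and> (\<forall>r\<ge>0. antimono_on {0..} (\<beta> r) \<and> ((\<beta> r) \<longlongrightarrow> 0) at_top)"

definition pos_def :: "(real \<Rightarrow> real) \<Rightarrow> bool" where
  "pos_def \<eta> \<longleftrightarrow> continuous_on {0..} \<eta> \<and> \<eta> 0 = 0 \<and> (\<forall>r>0. \<eta> r > 0)"

definition PC :: "(real \<Rightarrow> 'u::real_normed_vector) set" where
  "PC = {u. bounded (u ` {0..})
          \<and> (\<forall>t\<ge>0. continuous (at_right t) u)
          \<and> (\<forall>T. finite {t\<in>{0..T}. \<not> isCont u t})
          \<and> (\<forall>t>0. \<exists>l. (u \<longlongrightarrow> l) (at_left t))}"

definition evolution_family :: "(real \<Rightarrow> real \<Rightarrow> ('x::banach \<Rightarrow>\<^sub>L 'x)) \<Rightarrow> bool" where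
  "evolution_family W \<longleftrightarrow>
     (\<forall>s\<ge>0. W s s = id_blinfun)
   \<and> (\<forall>s r t. 0 \<le> s \<and> s \<le> r \<and> r \<le> t \<longrightarrow> W t s = W t r o\<^sub>L W r s)
   \<and> (\<forall>x. continuous_on {(t,s). 0 \<le> s \<and> s \<le> t} (\<lambda>(t,s). W t s x))"

text \<open>Generation by the family of (unbounded) operators A(t) with domains D(t).\<close>

definition generates_evolution ::
  "(real \<Rightarrow> 'x set) \<Rightarrow> (real \<Rightarrow> 'x \<Rightarrow> 'x) \<Rightarrow> (real \<Rightarrow> real \<Rightarrow> ('x::banach \<Rightarrow>\<^sub>L 'x)) \<Rightarrow> bool" where
  "generates_evolution D A W \<longleftrightarrow> evolution_family W
   \<and> (\<forall>s\<ge>0. \<forall>v\<in>D s. \<forall>t\<ge>s.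
        ((\<lambda>\<tau>. W \<tau> s v) has_vector_derivative A t (W t s v)) (at t within {s..}))
   \<and> (\<forall>t\<ge>0. \<forall>s\<in>{0..t}. \<forall>v\<in>D s.
        ((\<lambda>\<sigma>. W t \<sigma> v) has_vector_derivative - (W t s (A s v))) (at s within {0..t}))"

definition unif_exp_stable :: "(real \<Rightarrow> real \<Rightarrow> ('x::banach \<Rightarrow>\<^sub>L 'x)) \<Rightarrow> bool" where
  "unif_exp_stable W \<longleftrightarrow> (\<exists>k w. k > 0 \<and> w > 0 \<and>
      (\<forall>s t. 0 \<le> s \<and> s \<le> t \<longrightarrow> norm (W t s) \<le> k * exp (- w * (t - s))))"

definition H1 :: "(real \<Rightarrow> 'x::real_normed_vector \<Rightarrow> 'u::real_normed_vector \<Rightarrow> 'x) \<Rightarrow> bool" where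
  "H1 \<Psi> \<longleftrightarrow> (\<forall>x. continuous_on ({0..} \<times> UNIV) (\<lambda>(t,u). \<Psi> t x u))
     \<and> (\<forall>R T. \<exists>L. \<forall>t\<in>{0..T}. \<forall>x y u. norm x \<le> R \<and> norm y \<le> R \<and> norm u \<le> R \<longrightarrow>
            norm (\<Psi> t x u - \<Psi> t y u) \<le> L * norm (x - y))"

text \<open>x is a mild solution on the interval I (an interval with left end point t0, t0 \<in> I)
  of x(t) = W(t,t0) x0 + \<integral>_{t0}^t W(t,s) \<Psi>(s,x(s),u(s)) ds.\<close>

definition mild_solution_on ::
  "(real \<Rightarrow> real \<Rightarrow> ('x::banach \<Rightarrow>\<^sub>L 'x)) \<Rightarrow> (real \<Rightarrow> 'x \<Rightarrow> 'u \<Rightarrow> 'x) \<Rightarrow>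
   real \<Rightarrow> 'x \<Rightarrow> (real \<Rightarrow> 'u) \<Rightarrow> real set \<Rightarrow> (real \<Rightarrow> 'x) \<Rightarrow> bool" where
  "mild_solution_on W \<Psi> t0 x0 u I x \<longleftrightarrow> continuous_on I x \<and>
     (\<forall>t\<in>I. ((\<lambda>s. W t s (\<Psi> s (x s) (u s))) has_integral (x t - W t t0 x0)) {t0..t})"

definition forward_complete where
  "forward_complete W \<Psi> \<longleftrightarrow> (\<forall>t0\<ge>0. \<forall>x0. \<forall>u\<in>PC. \<exists>x. mild_solution_on W \<Psi> t0 x0 u {t0..} x)"

definition iISS where
  "iISS W \<Psi> \<longleftrightarrow> forward_complete W \<Psi> \<and>
     (\<exists>\<alpha> \<mu> \<beta>. class_Kinf \<alpha> \<and> class_K \<mu> \<and> class_KL \<beta> \<and>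
        (\<forall>t0\<ge>0. \<forall>x0. \<forall>u\<in>PC. \<forall>x. mild_solution_on W \<Psi> t0 x0 u {t0..} x \<longrightarrow>
          (\<forall>t\<ge>t0. norm (x t) \<le> \<beta> (norm x0) (t - t0)
                     + \<alpha> (integral {t0..t} (\<lambda>s. \<mu> (norm (u s)))))))"

text \<open>Upper Dini derivative of Z along the (unique) mild solution starting at (t, x0) with input u:
  the bound is required for every mild solution defined on some [t, t+e), e > 0.\<close>

definition lie_derivative_le ::
  "(real \<Rightarrow> real \<Rightarrow> ('x::banach \<Rightarrow>\<^sub>L 'x)) \<Rightarrow> (real \<Rightarrow> 'x \<Rightarrow> 'u \<Rightarrow> 'x) \<Rightarrow>
   (real \<Rightarrow> 'x \<Rightarrow> real) \<Rightarrow> real \<Rightarrow> 'x \<Rightarrow> (real \<Rightarrow> 'u) \<Rightarrow> real \<Rightarrow> bool" where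
  "lie_derivative_le W \<Psi> Z t x0 u c \<longleftrightarrow>
     (\<forall>e>0. \<forall>x. mild_solution_on W \<Psi> t x0 u {t..<t+e} x \<longrightarrow>
        Limsup (at_right 0) (\<lambda>h. ereal ((Z (t + h) (x (t + h)) - Z t x0) / h)) \<le> ereal c)"

definition coercive_iISS_Lyapunov where
  "coercive_iISS_Lyapunov W \<Psi> Z \<longleftrightarrow>
     continuous_on ({0..} \<times> UNIV) (\<lambda>(t,x). Z t x) \<and> (\<forall>t\<ge>0. Z t 0 = 0) \<and>
     (\<exists>\<alpha>1 \<alpha>2 \<eta> chi. class_Kinf \<alpha>1 \<and> class_Kinf \<alpha>2 \<and> pos_def \<eta> \<and> class_K chi \<and>
        (\<forall>t\<ge>0. \<forall>x. \<alpha>1 (norm x) \<le> Z t x \<and> Z t x \<le> \<alpha>2 (norm x)) \<and>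
        (\<forall>t\<ge>0. \<forall>x. \<forall>u\<in>PC. lie_derivative_le W \<Psi> Z t x u (- \<eta> (norm x) + chi (norm (u t)))))"

end

(*
  Write V for the integral functional and Z = ln (1 + V).  Exponential stability and the lower
  bound on W squeeze V(t, x) between two multiples of |x|^2.  Along a mild solution
  x(t+h) = W(t+h, t) x0 + y with |y| = O(h), so the upper Dini derivative of V is at most
  -|x0|^2 + (k^2/w) |x0| k (C |u| + gamma |x0| delta(|u|)); dividing by 1 + V (concavity of ln)
  turns the bilinear term into a function of u alone.

  The iISS estimate does not go through Z: Gronwall's inequality applied to e^{w(t-t0)} |x(t)| gives
  |x(t)| <= (k e^{-w(t-t0)} |x0| + k C I) e^{k gamma I}  with  I = int (|u| + delta(|u|)),
  and 2pq <= p^2 + q^2 separates the initial state from the input.  Global existence is Picard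
  iteration, where piecewise continuity of the input enters only through one-sided limits.
*)
theory Submission
  imports Defs "HOL-Real_Asymp.Real_Asymp"
begin

section \<open>Regulated functions and integral inequalities\<close>

text \<open>The bilinear growth \<open>\<gamma> |x| \<delta>(|v|)\<close> is the obstacle: it puts a
  term \<open>|x|^2 \<delta>(|u|)\<close> into the derivative of \<open>V\<close>, and no function
  of \<open>u\<close> alone dominates that. The logarithm has just the right strength. The lower
  bound on \<open>W\<close> keeps \<open>|x|^2 / (1 + V)\<close> bounded, so the term becomes a pure
  input gain; the price is a dissipation rate that stays bounded in \<open>|x|\<close> and is only
  positive definite. For the trajectory estimate the same growth is harmless: it is linear in
  \<open>|x|\<close>, so Gronwall costs only the exponential of an input integral, and the
  comparison functions come out explicitly. A mild solution need not be differentiable, so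
  \<open>V\<close> is never differentiated along it by a chain rule. The composition law of
  \<open>W\<close> identifies the unperturbed part of \<open>V (t + h)\<close> with a tail of the
  integral \<open>V t\<close>, and only the perturbation has to be estimated. All integrals over
  trajectories are vector valued with integrands that have one-sided limits but may jump; regulated
  functions are the class that fits.\<close>

text \<open>Both filters are relative to \<open>S\<close>, so at an end point the missing side is a
  trivial filter and imposes nothing. The limits may differ from each other and from the value
  \<open>f x\<close>.\<close>

definition regulated_on :: "real set \<Rightarrow> (real \<Rightarrow> 'a::topological_space) \<Rightarrow> bool" where
  "regulated_on S f \<longleftrightarrow> (\<forall>x\<in>S. (\<exists>l. (f \<longlongrightarrow> l) (at x within S \<inter> {..<x}))
                             \<and> (\<exists>r. (f \<longlongrightarrow> r) (at x within S \<inter> {x<..})))"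

lemma regulated_on_subset:
  assumes "regulated_on T f" "S \<subseteq> T"
  shows "regulated_on S f"
proof -
  have "S \<inter> {..<x} \<subseteq> T \<inter> {..<x}" "S \<inter> {x<..} \<subseteq> T \<inter> {x<..}" for x
    using assms(2) by auto
  then show ?thesis
    using assms unfolding regulated_on_def by (meson tendsto_within_subset subsetD)
qed

text \<open>Quantifying over every filter below \<open>at s within S\<close> treats both sides at
  once, and lets a factor that is continuous in \<open>s\<close> be combined with the one-sided
  limit \<open>v\<close> of \<open>u\<close>, whatever the value \<open>u s\<close> is.\<close>

lemma regulated_on_compose_tendsto:
  assumes u: "regulated_on S u"
    and lim: "\<And>s v F. s \<in> S \<Longrightarrow> (u \<longlongrightarrow> v) F \<Longrightarrow> F \<le> at s within S \<Longrightarrow> \<exists>l. (g \<longlongrightarrow> l) F"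
  shows "regulated_on S g"
  unfolding regulated_on_def
proof (intro ballI conjI)
  fix s assume s: "s \<in> S"
  have "at s within S \<inter> {..<s} \<le> at s within S" "at s within S \<inter> {s<..} \<le> at s within S"
    by (auto intro: at_le)
  with u s lim show "\<exists>l. (g \<longlongrightarrow> l) (at s within S \<inter> {..<s})" 
    "\<exists>l. (g \<longlongrightarrow> l) (at s within S \<inter> {s<..})"
    unfolding regulated_on_def by blast+
qed

lemma regulated_on_compose:
  assumes "regulated_on S u" "continuous_on UNIV g"
  shows "regulated_on S (\<lambda>s. g (u s))"
  using assms(1)
proof (rule regulated_on_compose_tendsto)
  fix v F assume "(u \<longlongrightarrow> v) F"
  then show "\<exists>l. ((\<lambda>s. g (u s)) \<longlongrightarrow> l) F"
    using continuous_on_tendsto_compose[OF assms(2)] by fastforce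
qed

text \<open>Near each point a regulated function is uniformly close to a step function with at most
  three values; the Bolzano bisection principle turns this into a uniform approximation on the
  whole interval.\<close>

lemma regulated_on_integrable:
  fixes f :: "real \<Rightarrow> 'a::banach"
  assumes "regulated_on {a..b} f"
  shows "f integrable_on {a..b}"
proof (cases "a \<le> b")
  case True
  \<comment> \<open>The bisection rule varies the end points over all intervals around a point,
    including ones that leave \<open>{a..b}\<close>. The name \<open>A\<close> keeps the outer
    interval from being abstracted, and the premise \<open>\<subseteq> A\<close> discards intervals
    that stick out.\<close>
  define A where "A = {a..b}"
  have "\<exists>g. (\<forall>x\<in>{a..b}. norm (f x - g x) \<le> e) \<and> g integrable_on {a..b}" if "e > 0" for e
  proof -
    have "{a..b} \<subseteq> A \<longrightarrow> (\<exists>g. (\<forall>x\<in>{a..b}. norm (f x - g x) \<le> e) \<and> g integrable_on {a..b})"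
      using True
    proof (induction rule: Bolzano)
      case (trans p q r)
      show ?case
      proof
        assume pr: "{p..r} \<subseteq> A"
        have pq: "{p..q} \<subseteq> A" "{q..r} \<subseteq> A" using pr trans(3,4) by auto
        obtain g where g: "\<forall>x\<in>{p..q}. norm (f x - g x) \<le> e" "g integrable_on {p..q}"
          using trans(1) pq(1) by blast
        obtain h where h: "\<forall>x\<in>{q..r}. norm (f x - h x) \<le> e" "h integrable_on {q..r}"
          using trans(2) pq(2) by blast
        let ?g = "\<lambda>x. if x \<le> q then g x else h x"
        have 1: "?g integrable_on {p..q}"
          by (rule integrable_spike_finite[OF _ _ g(2), of "{}"]) auto
        have 2: "?g integrable_on {q..r}"
          by (rule integrable_spike_finite[OF _ _ h(2), of "{q}"]) auto
        have "?g integrable_on {p..r}"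
          by (rule Henstock_Kurzweil_Integration.integrable_combine[OF trans(3,4) 1 2])
        then show "\<exists>g. (\<forall>x\<in>{p..r}. norm (f x - g x) \<le> e) \<and> g integrable_on {p..r}"
          using g(1) h(1) by (intro exI[of _ ?g]) auto
      qed
    next
      case (local x)
      then have "x \<in> {a..b}" by simp
      then obtain l r where l: "(f \<longlongrightarrow> l) (at x within {a..b} \<inter> {..<x})"
        and r: "(f \<longlongrightarrow> r) (at x within {a..b} \<inter> {x<..})"
        using assms unfolding regulated_on_def by blast
      obtain d1 where d1: "d1 > 0" "\<And>y. y \<in> {a..b} \<Longrightarrow> y < x \<Longrightarrow> dist y x < d1 \<Longrightarrow> dist (f y) l < e"
        using tendstoD[OF l \<open>e > 0\<close>] unfolding eventually_at by auto
      obtain d2 where d2: "d2 > 0" "\<And>y. y \<in> {a..b} \<Longrightarrow> x < y \<Longrightarrow> dist y x < d2 \<Longrightarrow> dist (f y) r < e"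
        using tendstoD[OF r \<open>e > 0\<close>] unfolding eventually_at by auto
      let ?g = "\<lambda>y. if y < x then l else if y = x then f x else r"
      show ?case
      proof (intro exI[of _ "min d1 d2"] conjI allI impI)
        fix p q assume pq: "p \<le> x \<and> x \<le> q \<and> q - p < min d1 d2" "{p..q} \<subseteq> A"
        have 1: "?g integrable_on {p..x}"
          by (rule integrable_spike_finite[of "{x}" _ _ "\<lambda>_. l"]) auto
        have 2: "?g integrable_on {x..q}"
          by (rule integrable_spike_finite[of "{x}" _ _ "\<lambda>_. r"]) auto
        have 3: "?g integrable_on {p..q}"
          using pq(1) by (intro Henstock_Kurzweil_Integration.integrable_combine[OF _ _ 1 2]) auto
        have 4: "norm (f y - ?g y) \<le> e" if y: "y \<in> {p..q}" for y
        proof -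
          have "y \<in> {a..b}" using y pq(2) by (auto simp: A_def)
          moreover have "dist y x < min d1 d2" using y pq(1) by (auto simp: dist_real_def)
          ultimately show ?thesis
            using d1(2)[of y] d2(2)[of y] \<open>e > 0\<close> by (auto simp: dist_norm)
        qed
        show "\<exists>g. (\<forall>x\<in>{p..q}. norm (f x - g x) \<le> e) \<and> g integrable_on {p..q}"
          by (intro exI[of _ ?g] conjI ballI 3 4)
      qed (use d1 d2 in auto)
    qed
    then show ?thesis by (simp add: A_def)
  qed
  then show ?thesis
    using integrable_uniform_limit[of a b f] by (simp add: cbox_interval)
qed auto

section \<open>Piecewise continuous inputs\<close>

lemma PC_bounded: 
  assumes "u \<in> PC" obtains c where "c > 0" "\<And>t. t \<ge> 0 \<Longrightarrow> norm (u t) \<le> c"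
proof -
  have "bounded (u ` {0..})" using assms by (auto simp: PC_def)
  then show ?thesis using that unfolding bounded_pos by auto
qed

lemma PC_regulated_on:
  assumes "u \<in> PC"
  shows "regulated_on {0..} u"
  unfolding regulated_on_def
proof (intro ballI conjI)
  fix t :: real assume t: "t \<in> {0..}"
  show "\<exists>l. (u \<longlongrightarrow> l) (at t within {0..} \<inter> {..<t})"
  proof (cases "t = 0")
    case True
    then have "{0..} \<inter> {..<t} = {}" by auto
    then show ?thesis by simp
  next
    case False
    then have "\<exists>l. (u \<longlongrightarrow> l) (at_left t)" using t assms by (auto simp: PC_def)
    then show ?thesis by (meson tendsto_within_subset inf_le2)
  qed
  have "(u \<longlongrightarrow> u t) (at_right t)"
    using t assms by (auto simp: PC_def continuous_within)
  then show "\<exists>l. (u \<longlongrightarrow> l) (at t within {0..} \<inter> {t<..})"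
    by (meson tendsto_within_subset inf_le2)
qed

text \<open>With \<open>Q\<close> the right-hand side of the hypothesis, \<open>Q exp (- G)\<close>
  is continuous and has derivative \<open>g (q - Q) exp (- G) \<le> 0\<close> wherever
  \<open>g\<close> is continuous. The fundamental theorem tolerates the finite set \<open>S\<close>,
  so jumps of the input do no harm.\<close>

lemma gronwall_piecewise:
  fixes g q :: "real \<Rightarrow> real"
  assumes "a \<le> b" and S: "finite S"
    and q: "continuous_on {a..b} q"
    and g: "g integrable_on {a..b}" "\<And>t. t \<in> {a..b} \<Longrightarrow> 0 \<le> g t"
      "\<And>t. t \<in> {a<..<b} - S \<Longrightarrow> isCont g t"
    and gq: "(\<lambda>t. g t * q t) integrable_on {a..b}"
    and le: "\<And>t. t \<in> {a..b} \<Longrightarrow> q t \<le> c + integral {a..t} (\<lambda>s. g s * q s)"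
  shows "q b \<le> c * exp (integral {a..b} g)"
proof -
  define Q where "Q = (\<lambda>t. c + integral {a..t} (\<lambda>s. g s * q s))"
  define G where "G = (\<lambda>t. integral {a..t} g)"
  define F where "F = (\<lambda>t. Q t * exp (- G t))"
  have "((\<lambda>t. g t * (q t - Q t) * exp (- G t)) has_integral (F b - F a)) {a..b}"
  proof (rule fundamental_theorem_of_calculus_interior_strong[OF S \<open>a \<le> b\<close>])
    show "continuous_on {a..b} F"
      unfolding F_def Q_def G_def
      by (intro continuous_intros indefinite_integral_continuous_1 g gq)
    fix t assume t: "t \<in> {a<..<b} - S"
    then have tt: "t \<in> {a..b} - {}" and ab: "at t within {a..b} = at t"
      by (auto intro: at_within_interior)
    have cq: "isCont q t"
      using t q by (auto intro: continuous_on_interior)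
    have "(G has_vector_derivative g t) (at t)"
      using integral_has_vector_derivative_continuous_at[OF g(1) tt] g(3)[OF t] ab
      by (simp add: G_def)
    moreover have "((\<lambda>t. integral {a..t} (\<lambda>s. g s * q s)) has_vector_derivative g t * q t) (at t)"
      using integral_has_vector_derivative_continuous_at[OF gq tt] g(3)[OF t] ab cq
      by (simp add: continuous_mult)
    ultimately have "(F has_field_derivative g t * (q t - Q t) * exp (- G t)) (at t)"
      unfolding F_def Q_def has_real_derivative_iff_has_vector_derivative[symmetric]
      by (auto intro!: derivative_eq_intros simp: algebra_simps)
    then show "(F has_vector_derivative g t * (q t - Q t) * exp (- G t)) (at t)"
      by (simp add: has_real_derivative_iff_has_vector_derivative)
  qed
  then have "F b - F a \<le> 0"
  proof (rule has_integral_le[OF _ has_integral_0])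
    show "g t * (q t - Q t) * exp (- G t) \<le> 0" if "t \<in> {a..b}" for t
      using g(2)[OF that] le[OF that]
      by (intro mult_nonpos_nonneg[OF mult_nonneg_nonpos]) (auto simp: Q_def)
  qed
  then have "Q b * exp (- G b) \<le> c"
    by (simp add: F_def Q_def G_def)
  then have "Q b \<le> c * exp (G b)"
    by (simp add: exp_minus field_simps)
  then show ?thesis
    using le[of b] \<open>a \<le> b\<close> by (simp add: Q_def G_def)
qed

section \<open>Exponential majorants on half-lines\<close>

lemma exp_has_integral_atLeast:
  fixes c :: real
  assumes "c > 0"
  shows "((\<lambda>s. K * exp (- c * (s - t))) has_integral K / c) {t..}"
proof -
  have "((\<lambda>s. (K * exp (c * t)) * exp (- c * s)) has_integral (K * exp (c * t)) * (exp (- c * t) / c)) {t..}"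
    using has_integral_exp_minus_to_infinity[OF \<open>c > 0\<close>, of t] by (rule has_integral_mult_right)
  also have "(\<lambda>s. (K * exp (c * t)) * exp (- c * s)) = (\<lambda>s. K * exp (- c * (s - t)))"
    by (simp add: algebra_simps flip: exp_add)
  also have "(K * exp (c * t)) * (exp (- c * t) / c) = K / c"
    by (simp add: exp_minus field_simps)
  finally show ?thesis .
qed

lemma exp_dominated_has_bounded_integral:
  fixes f :: "real \<Rightarrow> real"
  assumes "c > 0" and f: "continuous_on {t..} f"
    and le: "\<And>s. s \<ge> t \<Longrightarrow> \<bar>f s\<bar> \<le> K * exp (- c * (s - t))"
  shows "f integrable_on {t..}" "integral {t..} f \<le> K / c"
proof -
  note * = exp_has_integral_atLeast[OF \<open>c > 0\<close>, of K t]
  show int: "f integrable_on {t..}"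
  proof (rule integrable_on_all_intervals_integrable_bound)
    show "norm (f x) \<le> K * exp (- c * (x - t))" if "x \<in> {t..}" for x using le that by auto
    show "(\<lambda>x. if x \<in> {t..} then f x else 0) integrable_on cbox a b" for a b
    proof -
      have eq: "{a..b} \<inter> {t..} = {max t a..b}" by auto
      have "f integrable_on {max t a..b}"
        by (intro integrable_continuous_interval continuous_on_subset[OF f]) auto
      then have "(\<lambda>x. if x \<in> {t..} then f x else 0) integrable_on {a..b}"
        by (subst integrable_restrict_Int) (simp add: eq Int_commute)
      then show ?thesis by (simp add: cbox_interval)
    qed
  qed (use * in auto)
  show "integral {t..} f \<le> K / c"
    using int * le by (intro has_integral_le[OF integrable_integral[OF int] *]) force+
qed

section \<open>Exponentially stable evolution families\<close>

lemma H1_tendsto: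
  fixes \<Psi> :: "real \<Rightarrow> 'x::real_normed_vector \<Rightarrow> 'u::real_normed_vector \<Rightarrow> 'x"
  assumes H: "H1 \<Psi>"
    and S: "(S \<longlongrightarrow> s) F" and Y: "(Y \<longlongrightarrow> y) F" and V: "(V \<longlongrightarrow> v) F"
    and s: "0 \<le> s" and ev: "\<forall>\<^sub>F i in F. 0 \<le> S i"
  shows "((\<lambda>i. \<Psi> (S i) (Y i) (V i)) \<longlongrightarrow> \<Psi> s y v) F"
proof -
  \<comment> \<open>The extra 1 puts both limits strictly inside the ball, so that
    \<open>Y i\<close> and \<open>V i\<close> eventually lie in it.\<close>
  define R where "R = max (norm y) (norm v) + 1"
  obtain L where L: "\<And>t x y u. t \<in> {0..s+1} \<Longrightarrow> norm x \<le> R \<Longrightarrow> norm y \<le> R \<Longrightarrow> norm u \<le> R \<Longrightarrow>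
            norm (\<Psi> t x u - \<Psi> t y u) \<le> L * norm (x - y)"
    using H unfolding H1_def by meson
  have "continuous_on ({0..} \<times> UNIV) (\<lambda>(t,u). \<Psi> t y u)"
    using H by (auto simp: H1_def)
  then have 1: "((\<lambda>i. \<Psi> (S i) y (V i)) \<longlongrightarrow> \<Psi> s y v) F"
    using continuous_on_tendsto_compose[of _ "\<lambda>(t,u). \<Psi> t y u" "\<lambda>i. (S i, V i)" "(s, v)" F]
      tendsto_Pair[OF S V] s ev by (auto simp: case_prod_unfold)
  have "\<forall>\<^sub>F i in F. S i < s + 1" using order_tendstoD(2)[OF S] by simp
  moreover have "\<forall>\<^sub>F i in F. norm (Y i) < R" "\<forall>\<^sub>F i in F. norm (V i) < R"
    by (rule order_tendstoD(2)[OF tendsto_norm[OF Y]] order_tendstoD(2)[OF tendsto_norm[OF V]], 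
        simp add: R_def)+
  ultimately have "\<forall>\<^sub>F i in F. norm (\<Psi> (S i) (Y i) (V i) - \<Psi> (S i) y (V i)) \<le> L * norm (Y i - y)"
    using ev by eventually_elim (auto intro!: L simp: R_def)
  moreover have "((\<lambda>i. L * norm (Y i - y)) \<longlongrightarrow> 0) F"
    using tendsto_mult_right_zero[OF tendsto_norm_zero[OF LIM_zero[OF Y]]] by simp
  ultimately have "((\<lambda>i. \<Psi> (S i) (Y i) (V i) - \<Psi> (S i) y (V i)) \<longlongrightarrow> 0) F"
    by (rule Lim_null_comparison)
  from tendsto_add[OF this 1] show ?thesis by simp
qed

locale stable_evolution =
  fixes W :: "real \<Rightarrow> real \<Rightarrow> ('x::banach \<Rightarrow>\<^sub>L 'x)" and k w :: real
  assumes evolution: "evolution_family W"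
    and k_pos: "k > 0" and w_pos: "w > 0"
    and norm_W: "\<And>s t. 0 \<le> s \<Longrightarrow> s \<le> t \<Longrightarrow> norm (W t s) \<le> k * exp (- w * (t - s))"
begin

lemma W_refl [simp]: "0 \<le> s \<Longrightarrow> W s s x = x"
  using evolution by (simp add: evolution_family_def)

lemma W_comp: "0 \<le> s \<Longrightarrow> s \<le> r \<Longrightarrow> r \<le> t \<Longrightarrow> W t r (W r s x) = W t s x"
  using evolution unfolding evolution_family_def by (metis blinfun_apply_blinfun_compose)

lemma norm_W_apply_exp:
  assumes "0 \<le> s" "s \<le> t"
  shows "norm (W t s x) \<le> k * exp (- w * (t - s)) * norm x"
  using order_trans[OF norm_blinfun mult_right_mono[OF norm_W[OF assms] norm_ge_zero]] .

lemma norm_W_apply: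
  assumes "0 \<le> s" "s \<le> t"
  shows "norm (W t s x) \<le> k * norm x"
proof -
  have "k * exp (- w * (t - s)) * norm x \<le> k * 1 * norm x"
    using assms k_pos w_pos by (intro mult_left_mono mult_right_mono) (auto simp: mult_nonneg_nonneg)
  with norm_W_apply_exp[OF assms, of x] show ?thesis by simp
qed

text \<open>Strong continuity speaks about one fixed vector. The uniform bound \<open>k\<close> on
  the operators allows the vector to converge as well, after splitting off
  \<open>W (T i) (S i) (Y i - y)\<close>.\<close>

lemma W_tendsto:
  assumes T: "(T \<longlongrightarrow> t) F" and S: "(S \<longlongrightarrow> s) F" and Y: "(Y \<longlongrightarrow> y) F"
    and st: "0 \<le> s" "s \<le> t" and ev: "\<forall>\<^sub>F i in F. 0 \<le> S i \<and> S i \<le> T i"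
  shows "((\<lambda>i. W (T i) (S i) (Y i)) \<longlongrightarrow> W t s y) F"
proof -
  have "continuous_on {(t,s). 0 \<le> s \<and> s \<le> t} (\<lambda>(t,s). W t s y)"
    using evolution by (auto simp: evolution_family_def)
  then have 1: "((\<lambda>i. W (T i) (S i) y) \<longlongrightarrow> W t s y) F"
    using continuous_on_tendsto_compose[of _ "\<lambda>(t,s). W t s y" "\<lambda>i. (T i, S i)" "(t, s)" F]
      tendsto_Pair[OF T S] st ev by (auto simp: case_prod_unfold)
  have "\<forall>\<^sub>F i in F. norm (W (T i) (S i) (Y i - y)) \<le> k * norm (Y i - y)"
    using ev by eventually_elim (auto intro: norm_W_apply)
  moreover have "((\<lambda>i. k * norm (Y i - y)) \<longlongrightarrow> 0) F"
    using tendsto_mult_right_zero[OF tendsto_norm_zero[OF LIM_zero[OF Y]]] by simp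
  ultimately have "((\<lambda>i. W (T i) (S i) (Y i - y)) \<longlongrightarrow> 0) F"
    by (rule Lim_null_comparison)
  from tendsto_add[OF this 1] show ?thesis by (simp add: blinfun.diff_right)
qed

lemma continuous_on_W: "0 \<le> s \<Longrightarrow> continuous_on {s..} (\<lambda>t. W t s x)"
  unfolding continuous_on_def
  by (auto intro!: W_tendsto tendsto_ident_at tendsto_const simp: eventually_at_filter)

lemma regulated_on_W:
  assumes f: "regulated_on {t0..t} f" and "0 \<le> t0"
  shows "regulated_on {t0..t} (\<lambda>s. W t s (f s))"
  using f
proof (rule regulated_on_compose_tendsto)
  fix s v F assume s: "s \<in> {t0..t}" and v: "(f \<longlongrightarrow> v) F" and F: "F \<le> at s within {t0..t}"
  have "((\<lambda>s. s) \<longlongrightarrow> s) F" using F tendsto_ident_at by (rule tendsto_mono)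
  moreover have "\<forall>\<^sub>F i in F. 0 \<le> i \<and> i \<le> t" 
    using F by (rule filter_leD) (use \<open>0 \<le> t0\<close> in \<open>auto simp: eventually_at_filter\<close>)
  ultimately have "((\<lambda>s. W t s (f s)) \<longlongrightarrow> W t s v) F"
    using s \<open>0 \<le> t0\<close> v by (intro W_tendsto tendsto_const) auto
  then show "\<exists>l. ((\<lambda>s. W t s (f s)) \<longlongrightarrow> l) F" ..
qed

lemma W_integrable:
  assumes "regulated_on {t0..} f" "0 \<le> t0"
  shows "(\<lambda>s. W t s (f s)) integrable_on {t0..t}"
proof -
  have "regulated_on {t0..t} f" using assms(1) by (rule regulated_on_subset) auto
  then show ?thesis using assms(2) by (intro regulated_on_integrable regulated_on_W)
qed

text \<open>Both the upper limit and the kernel depend on \<open>t\<close>, and strong continuity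
  gives no uniform control of \<open>W t' s - W t s\<close>. So the integral is cut at a time
  \<open>r\<close> shortly before \<open>t\<close>: the part up to \<open>r\<close> is
  \<open>W t' r\<close> applied to one fixed vector, hence continuous in \<open>t'\<close>, and the
  rest is an integral over a short interval.\<close>

lemma continuous_on_convolution:
  assumes f: "regulated_on {t0..} f" and "0 \<le> t0"
    and bound: "\<And>T. \<exists>K. \<forall>s\<in>{t0..T}. norm (f s) \<le> K"
  shows "continuous_on {t0..} (\<lambda>t. integral {t0..t} (\<lambda>s. W t s (f s)))"
    (is "continuous_on _ ?J")
  unfolding continuous_on_iff
proof (intro ballI allI impI)
  fix t e :: real assume t: "t \<in> {t0..}" and "e > 0"
  obtain K0 where K0: "\<And>s. s\<in>{t0..t+1} \<Longrightarrow> norm (f s) \<le> K0"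
    using bound by meson
  define K where "K = max K0 1"
  have K: "K > 0" "\<And>s. s\<in>{t0..t+1} \<Longrightarrow> norm (f s) \<le> K"
    using K0 by (force simp: K_def)+
  \<comment> \<open>The remainders at \<open>t'\<close> and \<open>t\<close> have lengths at most
    \<open>2 d\<close> and \<open>d\<close>; together they cost
    \<open>3 k K d \<le> 3 e / 4\<close>, and the fixed-vector term takes the last quarter. The cap
    1 keeps \<open>t'\<close> where \<open>K\<close> is a bound.\<close>
  define d where "d = min 1 (e / (4 * k * K))"
  have d: "0 < d" "d \<le> 1" "4 * (k * K * d) \<le> e" 
    using K k_pos \<open>e > 0\<close> by (auto simp: d_def min_def field_simps)
  \<comment> \<open>This point lies below every admissible \<open>t'\<close> within \<open>d\<close>
    of \<open>t\<close>, so left and right continuity are proved together; the maximum keeps it in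
    the domain.\<close>
  define r where "r = max t0 (t - d)"
  have r: "t0 \<le> r" "r \<le> t" "t - r \<le> d" "0 \<le> r" using t d \<open>0 \<le> t0\<close> by (auto simp: r_def)
  have split: "norm (?J t' - W t' r (?J r)) \<le> k * K * (t' - r)" if t': "r \<le> t'" "t' \<le> t + 1" for t'
  proof -
    have int: "(\<lambda>s. W t' s (f s)) integrable_on {t0..t'}"
      using f \<open>0 \<le> t0\<close> by (rule W_integrable)
    have "W t' r (?J r) = integral {t0..r} (\<lambda>s. W t' r (W r s (f s)))"
      using integral_linear[OF W_integrable[OF f \<open>0 \<le> t0\<close>, of r] blinfun.bounded_linear_right[of "W t' r"]]
      by (simp add: o_def)
    also have "\<dots> = integral {t0..r} (\<lambda>s. W t' s (f s))"
      using r \<open>0 \<le> t0\<close> t' by (intro integral_cong) (simp add: W_comp)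
    finally have "?J t' - W t' r (?J r) = integral {r..t'} (\<lambda>s. W t' s (f s))"
      using Henstock_Kurzweil_Integration.integral_combine[OF _ _ int, of r] r t' by (simp add: algebra_simps)
    moreover have "norm (integral {r..t'} (\<lambda>s. W t' s (f s))) \<le> integral {r..t'} (\<lambda>s. k * K)"
    proof (rule integral_norm_bound_integral)
      show "(\<lambda>s. W t' s (f s)) integrable_on {r..t'}"
        using integrable_subinterval_real[OF int] r t' by auto
      show "norm (W t' s (f s)) \<le> k * K" if "s \<in> {r..t'}" for s
      proof -
        have "norm (W t' s (f s)) \<le> k * norm (f s)" using that r by (intro norm_W_apply) auto
        also have "\<dots> \<le> k * K" using that r t' k_pos by (intro mult_left_mono K) auto
        finally show ?thesis .
      qed
    qed auto
    ultimately show ?thesis using t' by (simp add: mult_ac)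
  qed
  have "continuous_on {r..} (\<lambda>t. W t r (?J r))" using r by (intro continuous_on_W)
  then have "((\<lambda>t. W t r (?J r)) \<longlongrightarrow> W t r (?J r)) (at t within {r..})"
    using r by (auto simp: continuous_on_def)
  then have "\<forall>\<^sub>F t' in at t within {r..}. dist (W t' r (?J r)) (W t r (?J r)) < e / 4"
    by (rule tendstoD) (use \<open>e > 0\<close> in simp)
  then obtain d' where d': "d' > 0" 
    "\<And>t'. t' \<in> {r..} \<Longrightarrow> t' \<noteq> t \<Longrightarrow> dist t' t < d' \<Longrightarrow> dist (W t' r (?J r)) (W t r (?J r)) < e / 4"
    unfolding eventually_at by blast
  show "\<exists>d>0. \<forall>t'\<in>{t0..}. dist t' t < d \<longrightarrow> dist (?J t') (?J t) < e"
  proof (intro exI[of _ "min d d'"] conjI ballI impI)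
    fix t' assume t': "t' \<in> {t0..}" "dist t' t < min d d'"
    then have rt: "r \<le> t'" "t' \<le> t + 1" "t' - r \<le> 2 * d" using d r by (auto simp: r_def dist_real_def)
    have "norm (?J t' - W t' r (?J r)) \<le> k * K * (2 * d)"
      using split[OF rt(1,2)] mult_left_mono[OF rt(3), of "k * K"] K(1) k_pos by (meson mult_pos_pos less_imp_le order_trans)
    moreover have "norm (?J t - W t r (?J r)) \<le> k * K * d"
      using order_trans[OF split[OF r(2)] mult_left_mono[OF r(3)]] K(1) k_pos by simp
    moreover have "norm (W t' r (?J r) - W t r (?J r)) < e / 4"
      using d'(2)[of t'] t' rt \<open>e > 0\<close> by (cases "t' = t") (auto simp: dist_norm)
    ultimately have "norm ((?J t' - W t' r (?J r)) + (W t' r (?J r) - W t r (?J r)) - (?J t - W t r (?J r)))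
       < k * K * (2 * d) + e / 4 + k * K * d"
      using norm_triangle_ineq4[of "(?J t' - W t' r (?J r)) + (W t' r (?J r) - W t r (?J r))" "?J t - W t r (?J r)"]
        norm_triangle_ineq[of "?J t' - W t' r (?J r)" "W t' r (?J r) - W t r (?J r)"] by linarith
    then show "dist (?J t') (?J t) < e" using d(3) by (simp add: dist_norm algebra_simps)
  qed (use d d' in auto)
qed

end

section \<open>Global mild solutions\<close>

lemma class_K_nonneg: "class_K \<alpha> \<Longrightarrow> 0 \<le> r \<Longrightarrow> 0 \<le> \<alpha> r"
  unfolding class_K_def strict_mono_on_def by (metis atLeast_iff less_eq_real_def order_refl)

lemma class_K_mono: "class_K \<alpha> \<Longrightarrow> 0 \<le> r \<Longrightarrow> r \<le> s \<Longrightarrow> \<alpha> r \<le> \<alpha> s"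
  unfolding class_K_def strict_mono_on_def by (metis atLeast_iff less_eq_real_def order_trans)

lemma exp_has_integral:
  fixes b :: real
  assumes "b \<noteq> 0" "t0 \<le> t"
  shows "((\<lambda>s. exp (b * (s - t0))) has_integral (exp (b * (t - t0)) - 1) / b) {t0..t}"
proof -
  have "((\<lambda>s. exp (b * (s - t0))) has_integral exp (b * (t - t0)) / b - exp (b * (t0 - t0)) / b) {t0..t}"
    using assms
    by (intro fundamental_theorem_of_calculus)
       (auto intro!: derivative_eq_intros simp flip: has_real_derivative_iff_has_vector_derivative)
  then show ?thesis by (simp add: diff_divide_distrib)
qed

text \<open>\<open>growth\<close> merges the linear input term and \<open>\<psi>\<close> into one
  bound, affine in \<open>norm x\<close> for a fixed input value. It is used both against blow-up
  and in the stability and dissipation estimates.\<close>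

locale controlled_system = stable_evolution W k w
  for W :: "real \<Rightarrow> real \<Rightarrow> ('x::banach \<Rightarrow>\<^sub>L 'x)" and k w +
  fixes \<Psi> :: "real \<Rightarrow> 'x \<Rightarrow> 'u::real_normed_vector \<Rightarrow> 'x" and C \<gamma> :: real and \<delta> :: "real \<Rightarrow> real"
  assumes H1_\<Psi>: "H1 \<Psi>" and C_pos: "C > 0" and \<gamma>_pos: "\<gamma> > 0" and \<delta>_K: "class_K \<delta>"
    and growth: "\<And>t x v. 0 \<le> t \<Longrightarrow> norm (\<Psi> t x v) \<le> C * norm v + \<gamma> * norm x * \<delta> (norm v)"
begin

lemma regulated_on_\<Psi>:
  assumes y: "continuous_on {t0..} y" and u: "u \<in> PC" and "0 \<le> t0"
  shows "regulated_on {t0..} (\<lambda>s. \<Psi> s (y s) (u s))"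
proof (rule regulated_on_compose_tendsto)
  show "regulated_on {t0..} u"
    using PC_regulated_on[OF u] by (rule regulated_on_subset) (use \<open>0 \<le> t0\<close> in auto)
  fix s v F assume s: "s \<in> {t0..}" and v: "(u \<longlongrightarrow> v) F" and F: "F \<le> at s within {t0..}"
  have "((\<lambda>s. s) \<longlongrightarrow> s) F" using F tendsto_ident_at by (rule tendsto_mono)
  moreover have "(y \<longlongrightarrow> y s) F" using F y s by (auto simp: continuous_on_def intro: tendsto_mono)
  moreover have "\<forall>\<^sub>F i in F. 0 \<le> i" 
    using F by (rule filter_leD) (use \<open>0 \<le> t0\<close> in \<open>auto simp: eventually_at_filter\<close>)
  ultimately have "((\<lambda>s. \<Psi> s (y s) (u s)) \<longlongrightarrow> \<Psi> s (y s) v) F"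
    using s \<open>0 \<le> t0\<close> v by (intro H1_tendsto[OF H1_\<Psi>]) auto
  then show "\<exists>l. ((\<lambda>s. \<Psi> s (y s) (u s)) \<longlongrightarrow> l) F" ..
qed

lemma growth_bounded:
  assumes "0 \<le> t" "norm v \<le> c" 
  shows "norm (\<Psi> t x v) \<le> C * c + \<gamma> * \<delta> c * norm x"
proof -
  have "C * norm v + \<gamma> * norm x * \<delta> (norm v) \<le> C * c + \<gamma> * norm x * \<delta> c"
    using assms C_pos \<gamma>_pos 
    by (intro add_mono mult_left_mono class_K_mono[OF \<delta>_K]) auto
  with growth[OF assms(1), of x v] show ?thesis by (simp add: mult_ac)
qed

text \<open>A bounded input makes the growth affine in the state, so all Picard iterates share one
  exponential bound on the whole half-line. On each compact interval they stay in a fixed ball,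
  where \<open>H1\<close> supplies a Lipschitz constant; the limit is therefore global at once and
  no continuation argument arises.\<close>

lemma exists_mild_solution:
  assumes t0: "0 \<le> t0" and u: "u \<in> PC"
  shows "\<exists>x. mild_solution_on W \<Psi> t0 x0 u {t0..} x"
proof -
  obtain c where c: "c > 0" "\<And>t. t \<ge> 0 \<Longrightarrow> norm (u t) \<le> c"
    using PC_bounded[OF u] by blast
  define f where "f = (\<lambda>y s. \<Psi> s (y s) (u s))"
  define P where "P = (\<lambda>y t. W t t0 x0 + integral {t0..t} (\<lambda>s. W t s (f y s)))"
  \<comment> \<open>Starting from the zero function makes the telescoping sum of increments equal to
    \<open>X n\<close> itself.\<close>
  define X where "X = (\<lambda>n. (P ^^ n) (\<lambda>_. 0))"
  have X_Suc: "X (Suc n) = P (X n)" for n by (simp add: X_def)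
  define c1 c2 where "c1 = C * c" and "c2 = \<gamma> * \<delta> c"
  have c12: "c1 \<ge> 0" "c2 \<ge> 0"
    using C_pos \<gamma>_pos c class_K_nonneg[OF \<delta>_K, of c] by (auto simp: c1_def c2_def)
  have f_le: "norm (f y s) \<le> c1 + c2 * norm (y s)" if "0 \<le> s" for y s
    unfolding f_def c1_def c2_def by (intro growth_bounded c that)
  have reg: "regulated_on {t0..} (f y)" if "continuous_on {t0..} y" for y
    unfolding f_def using that u t0 by (rule regulated_on_\<Psi>)
  have int: "(\<lambda>s. W t s (f y s)) integrable_on {t0..t}" if "continuous_on {t0..} y" for y t
    using reg[OF that] t0 by (rule W_integrable)
  have P_cont: "continuous_on {t0..} (P y)" if y: "continuous_on {t0..} y" for y
    unfolding P_def
  proof (intro continuous_on_add continuous_on_W t0 continuous_on_convolution reg y)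
    fix T
    have "compact (y ` {t0..T})"
      using y by (intro compact_continuous_image continuous_on_subset[OF y]) auto
    then obtain K where K: "\<And>s. s \<in> {t0..T} \<Longrightarrow> norm (y s) \<le> K"
      by (meson bounded_iff compact_imp_bounded imageI)
    have "norm (f y s) \<le> c1 + c2 * K" if "s \<in> {t0..T}" for s
      using f_le[of s y] mult_left_mono[OF K[OF that] c12(2)] that t0 by auto
    then show "\<exists>K. \<forall>s\<in>{t0..T}. norm (f y s) \<le> K" by blast
  qed
  have X_cont: "continuous_on {t0..} (X n)" for n
    by (induction n) (auto simp: X_Suc P_cont, simp add: X_def)
  \<comment> \<open>Each half of \<open>a exp (b (t - t0))\<close> absorbs one term of the Picard
    map: \<open>k |x0| \<le> a / 2\<close> for the free motion, and
    \<open>k (c1 + c2 a) / b \<le> a / 2\<close> for the integral, which reduces to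
    \<open>c1 \<le> a\<close>.\<close>
  define a b where "a = 2 * k * norm x0 + c1" and "b = 2 * k * (c2 + 1)"
  have ab: "a \<ge> 0" "b > 0" using k_pos c12 by (auto simp: a_def b_def)
  have scale_b: "k * p * (q / b) = p / (c2 + 1) * (q / 2)" for p q
    using k_pos c12 by (simp add: b_def divide_simps)
  text \<open>The exponential bound is reproduced by the Picard map, so no a priori estimate on
    solutions and no cut-off of the nonlinearity is needed.\<close>
  have X_bound: "norm (X n t) \<le> a * exp (b * (t - t0))" if "t \<ge> t0" for n t
    using that
  proof (induction n arbitrary: t)
    case 0
    then show ?case using ab by (simp add: X_def)
  next
    case (Suc n)
    let ?E = "exp (b * (t - t0))"
    have E: "?E \<ge> 1" using Suc.prems ab by simp
    have "norm (integral {t0..t} (\<lambda>s. W t s (f (X n) s)))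
        \<le> integral {t0..t} (\<lambda>s. k * (c1 + c2 * a) * exp (b * (s - t0)))"
    proof (rule integral_norm_bound_integral[OF int[OF X_cont]])
      show "(\<lambda>s. k * (c1 + c2 * a) * exp (b * (s - t0))) integrable_on {t0..t}"
        by (intro integrable_continuous_interval continuous_intros)
      fix s assume s: "s \<in> {t0..t}"
      have "norm (W t s (f (X n) s)) \<le> k * norm (f (X n) s)"
        using s t0 by (intro norm_W_apply) auto
      also have "norm (f (X n) s) \<le> c1 + c2 * norm (X n s)" using s t0 by (intro f_le) auto
      also have "\<dots> \<le> c1 * exp (b * (s - t0)) + c2 * (a * exp (b * (s - t0)))"
        using Suc.IH[of s] c12 s ab by (intro add_mono mult_left_mono) (auto simp: mult_le_cancel_left1)
      finally show "norm (W t s (f (X n) s)) \<le> k * (c1 + c2 * a) * exp (b * (s - t0))"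
        using k_pos by (simp add: algebra_simps)
    qed
    also have "\<dots> = k * (c1 + c2 * a) * ((?E - 1) / b)"
      using integral_unique[OF exp_has_integral[of b t0 t]] ab Suc.prems by simp
    also have "\<dots> \<le> k * (c1 + c2 * a) * (?E / b)"
      using k_pos c12 ab by (intro mult_left_mono divide_right_mono) auto
    also have "\<dots> = (c1 + c2 * a) / (c2 + 1) * (?E / 2)"
      by (rule scale_b)
    also have "\<dots> \<le> a * (?E / 2)"
    proof (rule mult_right_mono)
      have "c1 \<le> a" using k_pos by (simp add: a_def)
      then show "(c1 + c2 * a) / (c2 + 1) \<le> a" using c12 by (simp add: divide_le_eq algebra_simps)
    qed auto
    finally have "norm (integral {t0..t} (\<lambda>s. W t s (f (X n) s))) \<le> a * (?E / 2)" .
    moreover have "norm (W t t0 x0) \<le> a * (?E / 2)"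
    proof -
      have "norm (W t t0 x0) \<le> k * norm x0" using Suc.prems t0 by (intro norm_W_apply) auto
      also have "\<dots> \<le> a * (1 / 2)" using c12 by (simp add: a_def)
      also have "\<dots> \<le> a * (?E / 2)" using E ab by (intro mult_left_mono) auto
      finally show ?thesis .
    qed
    ultimately have "norm (W t t0 x0) + norm (integral {t0..t} (\<lambda>s. W t s (f (X n) s))) \<le> a * ?E"
      by simp
    then show ?case
      unfolding X_Suc P_def by (rule norm_triangle_le)
  qed
  have lipschitz: "\<exists>L>0. \<exists>R\<ge>0. (\<forall>n. \<forall>s\<in>{t0..T}. norm (X n s) \<le> R) \<and>
      (\<forall>s\<in>{t0..T}. \<forall>y z. norm (y s) \<le> R \<longrightarrow> norm (z s) \<le> R \<longrightarrow> norm (f y s - f z s) \<le> L * norm (y s - z s))"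
    for T
  proof -
    \<comment> \<open>\<open>H1\<close> uses a single radius for states and inputs, so
      \<open>R\<close> must dominate both the iterates and \<open>c\<close>.\<close>
    define R where "R = max (a * exp (b * (T - t0))) c"
    obtain L0 where L0: "\<And>t x y u. t \<in> {0..T} \<Longrightarrow> norm x \<le> R \<Longrightarrow> norm y \<le> R \<Longrightarrow> norm u \<le> R \<Longrightarrow>
            norm (\<Psi> t x u - \<Psi> t y u) \<le> L0 * norm (x - y)"
      using H1_\<Psi> unfolding H1_def by meson
    have 1: "norm (X n s) \<le> R" if "s \<in> {t0..T}" for n s
    proof -
      have "norm (X n s) \<le> a * exp (b * (s - t0))" using X_bound that by auto
      also have "\<dots> \<le> a * exp (b * (T - t0))" using that ab by (intro mult_left_mono) auto
      finally show ?thesis by (simp add: R_def)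
    qed
    have 2: "norm (f y s - f z s) \<le> max L0 1 * norm (y s - z s)"
      if "s \<in> {t0..T}" "norm (y s) \<le> R" "norm (z s) \<le> R" for s y z
    proof -
      have "norm (u s) \<le> R" using c(2)[of s] that t0 by (auto simp: R_def)
      then have "norm (f y s - f z s) \<le> L0 * norm (y s - z s)"
        unfolding f_def using that t0 by (intro L0) auto
      also have "\<dots> \<le> max L0 1 * norm (y s - z s)" by (intro mult_right_mono) auto
      finally show ?thesis .
    qed
    have "R \<ge> 0" using c by (auto simp: R_def)
    with 1 2 show ?thesis by (intro exI[of _ "max L0 1"] conjI exI[of _ R]) auto
  qed
  have P_diff: "norm (P y t - P z t) \<le> integral {t0..t} g"
    if "continuous_on {t0..} y" "continuous_on {t0..} z" "g integrable_on {t0..t}"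
      "\<And>s. s \<in> {t0..t} \<Longrightarrow> k * norm (f y s - f z s) \<le> g s" for y z g t
  proof -
    have "P y t - P z t = integral {t0..t} (\<lambda>s. W t s (f y s - f z s))"
      using integral_diff[OF int[OF that(1)] int[OF that(2)], of t] 
      by (simp add: P_def blinfun.diff_right)
    also have "norm \<dots> \<le> integral {t0..t} g"
    proof (rule integral_norm_bound_integral[OF _ that(3)])
      show "(\<lambda>s. W t s (f y s - f z s)) integrable_on {t0..t}"
        using integrable_diff[OF int[OF that(1)] int[OF that(2)], of t] by (simp add: blinfun.diff_right)
      show "norm (W t s (f y s - f z s)) \<le> g s" if s: "s \<in> {t0..t}" for s
        using norm_W_apply[of s t "f y s - f z s"] s t0 \<open>\<And>s. s \<in> {t0..t} \<Longrightarrow> k * norm (f y s - f z s) \<le> g s\<close>[OF s]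
        by auto
    qed
    finally show ?thesis .
  qed
  have step: "\<exists>K\<ge>0. \<forall>n. \<forall>t\<in>{t0..T}. norm (X (Suc n) t - X n t) \<le> K * (1/2) ^ n" for T
  proof -
    obtain L R where L: "L > 0" and R: "R \<ge> 0" and X_R: "\<And>n s. s \<in> {t0..T} \<Longrightarrow> norm (X n s) \<le> R"
      and Lip: "\<And>s y z. s\<in>{t0..T} \<Longrightarrow> norm (y s) \<le> R \<Longrightarrow> norm (z s) \<le> R \<Longrightarrow> 
            norm (f y s - f z s) \<le> L * norm (y s - z s)"
      using lipschitz[of T] by blast
    \<comment> \<open>The rate of a Bielecki weight: integrating \<open>k L exp (m (s - t0))\<close>
      costs the factor \<open>k L / m = 1/2\<close>, so the Picard map halves increments on an
      interval of any length.\<close>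
    define m where "m = 2 * k * L"
    have m: "m > 0" using L k_pos by (simp add: m_def)
    have scale_m: "k * L * p * (q / m) = p * (1/2) * q" for p q
      using L k_pos by (simp add: m_def)
    have *: "norm (X (Suc n) t - X n t) \<le> 2 * R * (1/2) ^ n * exp (m * (t - t0))" if "t \<in> {t0..T}" for n t
      using that
    proof (induction n arbitrary: t)
      case 0
      have "norm (X (Suc 0) t - X 0 t) \<le> 2 * R"
        using norm_triangle_le_diff[of "X (Suc 0) t" "X 0 t" "2 * R"] X_R[OF 0, of "Suc 0"] X_R[OF 0, of 0] by auto
      also have "\<dots> \<le> 2 * R * exp (m * (t - t0))"
        using R m 0 by (simp add: mult_le_cancel_left1)
      finally show ?case by simp
    next
      case (Suc n)
      let ?K = "2 * R * (1/2) ^ n"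
      have "norm (P (X (Suc n)) t - P (X n) t) \<le> integral {t0..t} (\<lambda>s. k * L * ?K * exp (m * (s - t0)))"
      proof (rule P_diff[OF X_cont X_cont])
        show "(\<lambda>s. k * L * ?K * exp (m * (s - t0))) integrable_on {t0..t}"
          by (intro integrable_continuous_interval continuous_intros)
        fix s assume s: "s \<in> {t0..t}"
        then have sT: "s \<in> {t0..T}" using Suc.prems by auto
        have "k * norm (f (X (Suc n)) s - f (X n) s) \<le> k * (L * norm (X (Suc n) s - X n s))"
          using k_pos by (intro mult_left_mono Lip sT X_R) auto
        also have "\<dots> \<le> k * (L * (?K * exp (m * (s - t0))))"
          using k_pos L by (intro mult_left_mono Suc.IH sT) auto
        finally show "k * norm (f (X (Suc n)) s - f (X n) s) \<le> k * L * ?K * exp (m * (s - t0))"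
          by (simp add: mult_ac)
      qed
      also have "\<dots> = k * L * ?K * ((exp (m * (t - t0)) - 1) / m)"
        using integral_unique[OF exp_has_integral[of m t0 t]] m Suc.prems by simp
      also have "\<dots> \<le> k * L * ?K * (exp (m * (t - t0)) / m)"
        using k_pos L R m by (intro mult_left_mono divide_right_mono) auto
      also have "\<dots> = 2 * R * (1/2) ^ Suc n * exp (m * (t - t0))"
        unfolding scale_m by simp
      finally show ?case by (simp only: X_Suc)
    qed
    have "norm (X (Suc n) t - X n t) \<le> 2 * R * exp (m * (T - t0)) * (1/2) ^ n" if "t \<in> {t0..T}" for n t
    proof -
      have "2 * R * (1/2) ^ n * exp (m * (t - t0)) \<le> 2 * R * (1/2) ^ n * exp (m * (T - t0))"
        using R m that by (intro mult_left_mono) auto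
      with *[OF that, of n] show ?thesis by (simp add: mult_ac)
    qed
    then show ?thesis using R by (intro exI[of _ "2 * R * exp (m * (T - t0))"]) auto
  qed
  \<comment> \<open>The series is defined without reference to \<open>T\<close>, so the uniform
    limits on the various compact intervals are restrictions of one function.\<close>
  define x where "x = (\<lambda>t. \<Sum>n. X (Suc n) t - X n t)"
  have unif: "uniform_limit {t0..T} X x sequentially" for T
  proof -
    obtain K where "\<And>n t. t\<in>{t0..T} \<Longrightarrow> norm (X (Suc n) t - X n t) \<le> K * (1/2) ^ n"
      using step[of T] by blast
    then have "uniform_limit {t0..T} (\<lambda>n t. \<Sum>i<n. X (Suc i) t - X i t) x sequentially"
      unfolding x_def by (rule Weierstrass_m_test) (auto intro!: summable_mult summable_geometric)
    moreover have "(\<lambda>n t. \<Sum>i<n. X (Suc i) t - X i t) = X"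
    proof (intro ext)
      show "(\<Sum>i<n. X (Suc i) t - X i t) = X n t" for n t
        using sum_lessThan_telescope[of "\<lambda>i. X i t" n] by (simp add: X_def)
    qed
    ultimately show ?thesis by simp
  qed
  have x_cont: "continuous_on {t0..} x"
  proof -
    have "continuous_on {t0..T} x" for T
      by (rule uniform_limit_theorem[OF _ unif]) (auto intro!: always_eventually continuous_on_subset[OF X_cont])
    then have "continuous (at t within {t0..}) x" if "t \<ge> t0" for t
    proof -
      have "continuous (at t within {t0..t+1}) x"
        using \<open>\<And>T. continuous_on {t0..T} x\<close>[of "t+1"] that by (simp add: continuous_on_eq_continuous_within)
      moreover have "at t within {t0..t+1} = at t within {t0..}"
        by (rule at_within_nhd[of _ "{t-1<..<t+1}"]) auto
      ultimately show ?thesis by simp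
    qed
    then show ?thesis by (simp add: continuous_on_eq_continuous_within)
  qed
  have fixpoint: "x t = P x t" if t: "t \<ge> t0" for t
  proof -
    obtain L R where L: "L > 0" and X_R: "\<And>n s. s \<in> {t0..t} \<Longrightarrow> norm (X n s) \<le> R"
      and Lip: "\<And>s y z. s\<in>{t0..t} \<Longrightarrow> norm (y s) \<le> R \<Longrightarrow> norm (z s) \<le> R \<Longrightarrow> 
            norm (f y s - f z s) \<le> L * norm (y s - z s)"
      using lipschitz[of t] by blast
    have lim: "(\<lambda>n. X n s) \<longlonglongrightarrow> x s" if "s \<in> {t0..t}" for s
      using unif[of t] that by (rule tendsto_uniform_limitI)
    have x_R: "norm (x s) \<le> R" if "s \<in> {t0..t}" for s
      using tendsto_norm[OF lim[OF that]] X_R[OF that] by (intro LIMSEQ_le_const2) auto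
    have "(\<lambda>n. P (X n) t) \<longlonglongrightarrow> P x t"
      unfolding tendsto_iff
    proof (intro allI impI)
      fix e :: real assume "e > 0"
      \<comment> \<open>The integrated error is at most
        \<open>e (t - t0) / (t - t0 + 1) < e\<close>; the added 1 also covers
        \<open>t = t0\<close>.\<close>
      define e' where "e' = e / (k * L * (t - t0 + 1))"
      have kLe: "k * L * e' = e / (t - t0 + 1)" using L k_pos by (simp add: e'_def)
      have e': "e' > 0" using \<open>e > 0\<close> L k_pos t by (simp add: e'_def)
      have "\<forall>\<^sub>F n in sequentially. \<forall>s\<in>{t0..t}. dist (X n s) (x s) < e'"
        using uniform_limitD[OF unif e'] .
      then show "\<forall>\<^sub>F n in sequentially. dist (P (X n) t) (P x t) < e"
      proof eventually_elim
        case (elim n)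
        have "norm (P (X n) t - P x t) \<le> integral {t0..t} (\<lambda>s. k * L * e')"
        proof (rule P_diff[OF X_cont x_cont])
          fix s assume s: "s \<in> {t0..t}"
          have "k * norm (f (X n) s - f x s) \<le> k * (L * norm (X n s - x s))"
            using k_pos by (intro mult_left_mono Lip s X_R x_R) auto
          also have "\<dots> \<le> k * (L * e')"
            using k_pos L elim s by (intro mult_left_mono) (auto simp: dist_norm less_imp_le)
          finally show "k * norm (f (X n) s - f x s) \<le> k * L * e'" by simp
        qed auto
        also have "\<dots> = e * ((t - t0) / (t - t0 + 1))" 
          using t kLe by (simp add: mult.commute)
        also have "\<dots> < e * 1" using t \<open>e > 0\<close> by (intro mult_strict_left_mono) auto
        finally show ?case by (simp add: dist_norm)
      qed
    qed
    moreover have "(\<lambda>n. P (X n) t) \<longlonglongrightarrow> x t"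
      using LIMSEQ_Suc[OF lim[of t]] t by (simp add: X_Suc)
    ultimately show ?thesis using LIMSEQ_unique by blast
  qed
  have "mild_solution_on W \<Psi> t0 x0 u {t0..} x"
    unfolding mild_solution_on_def
  proof (intro conjI x_cont ballI)
    fix t assume "t \<in> {t0..}"
    then have "integral {t0..t} (\<lambda>s. W t s (f x s)) = x t - W t t0 x0"
      using fixpoint[of t] by (simp add: P_def)
    then show "((\<lambda>s. W t s (\<Psi> s (x s) (u s))) has_integral x t - W t t0 x0) {t0..t}"
      using integrable_integral[OF int[OF x_cont], of t] by (simp add: f_def)
  qed
  then show ?thesis by blast
qed

end

section \<open>The integral input-to-state estimate\<close>

lemma regulated_on_mult_continuous:
  fixes f q :: "real \<Rightarrow> real"
  assumes f: "regulated_on S f" and q: "continuous_on S q"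
  shows "regulated_on S (\<lambda>s. f s * q s)"
  using f
proof (rule regulated_on_compose_tendsto)
  fix s v F assume s: "s \<in> S" and v: "(f \<longlongrightarrow> v) F" and F: "F \<le> at s within S"
  have "(q \<longlongrightarrow> q s) F" using F q s by (auto simp: continuous_on_def intro: tendsto_mono)
  then show "\<exists>l. ((\<lambda>s. f s * q s) \<longlongrightarrow> l) F" using v tendsto_mult by blast
qed

lemma continuous_on_class_K_norm:
  assumes "class_K \<alpha>"
  shows "continuous_on UNIV (\<lambda>v::'a::real_normed_vector. \<alpha> (norm v))"
  using assms unfolding class_K_def
  by (auto intro!: continuous_on_compose2[of "{0..}" \<alpha> UNIV norm] continuous_on_norm_id)

context controlled_system
begin

text \<open>The iISS estimate admits a single input gauge. The sum \<open>r + \<delta> r\<close>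
  dominates both the additive effect of the input and its multiplicative effect on the
  state.\<close>

definition total_input :: "(real \<Rightarrow> 'u) \<Rightarrow> real \<Rightarrow> real \<Rightarrow> real" where
  "total_input u t0 t = integral {t0..t} (\<lambda>s. norm (u s) + \<delta> (norm (u s)))"

text \<open>Weighting by \<open>exp (w (s - t0))\<close> cancels the decay of the kernel and leaves
  a Gronwall inequality for \<open>q\<close>. Removing the weight at the end returns the decay to
  the initial state.\<close>

lemma mild_solution_bound:
  assumes t0: "0 \<le> t0" and u: "u \<in> PC" and x: "mild_solution_on W \<Psi> t0 x0 u {t0..} x"
    and t: "t0 \<le> t"
  shows "norm (x t) \<le> (k * exp (- w * (t - t0)) * norm x0 + k * C * total_input u t0 t)
                         * exp (k * \<gamma> * total_input u t0 t)"
proof -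
  define d where "d = (\<lambda>s. \<delta> (norm (u s)))"
  define g where "g = (\<lambda>s. k * \<gamma> * d s)"
  define q where "q = (\<lambda>s. exp (w * (s - t0)) * norm (x s))"
  define I where "I = total_input u t0 t"
  have d_nn: "d s \<ge> 0" for s unfolding d_def by (intro class_K_nonneg[OF \<delta>_K]) auto
  have x_cont: "continuous_on {t0..} x" using x by (auto simp: mild_solution_on_def)
  have regu: "regulated_on {t0..t} u"
    using PC_regulated_on[OF u] by (rule regulated_on_subset) (use t0 in auto)
  have u_int: "(\<lambda>s. norm (u s)) integrable_on {t0..s}" if "s \<le> t" for s
    using regulated_on_integrable[OF regulated_on_compose[OF regu continuous_on_norm_id]] that
    by (auto intro: integrable_subinterval_real)
  have regd: "regulated_on {t0..t} d"
    unfolding d_def by (rule regulated_on_compose[OF regu continuous_on_class_K_norm[OF \<delta>_K]])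
  have d_int: "d integrable_on {t0..t}" using regd by (rule regulated_on_integrable)
  have q_cont: "continuous_on {t0..t} q"
    unfolding q_def by (intro continuous_intros continuous_on_subset[OF x_cont]) auto
  have gq_int: "(\<lambda>s. g s * q s) integrable_on {t0..s}" if "s \<le> t" for s
  proof -
    have "(\<lambda>s. d s * q s) integrable_on {t0..t}"
      by (intro regulated_on_integrable regulated_on_mult_continuous regd q_cont)
    then have "(\<lambda>s. k * \<gamma> * (d s * q s)) integrable_on {t0..t}" by (rule integrable_on_mult_right)
    then show ?thesis using that by (auto simp: g_def mult.assoc intro: integrable_subinterval_real)
  qed
  \<comment> \<open>Gronwall needs a constant here, so the weight on the additive input term is
    frozen at its largest value, the one at the final time \<open>t\<close>. Multiplication by
    \<open>exp (- w (t - t0))\<close> later cancels it exactly.\<close>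
  define c where "c = k * norm x0 + k * C * exp (w * (t - t0)) * integral {t0..t} (\<lambda>s. norm (u s))"
  have "q t \<le> c * exp (integral {t0..t} g)"
  proof (rule gronwall_piecewise[OF t, of "{s \<in> {0..t}. \<not> isCont u s}"])
    show "finite {s \<in> {0..t}. \<not> isCont u s}" using u by (auto simp: PC_def)
    show "continuous_on {t0..t} q" by (rule q_cont)
    show "g integrable_on {t0..t}" unfolding g_def using d_int by (rule integrable_on_mult_right)
    show "0 \<le> g s" for s using k_pos \<gamma>_pos d_nn by (simp add: g_def)
    show "(\<lambda>s. g s * q s) integrable_on {t0..t}" by (rule gq_int) simp
    show "isCont g s" if "s \<in> {t0<..<t} - {s \<in> {0..t}. \<not> isCont u s}" for s
    proof -
      have "isCont u s" using that t0 by auto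
      moreover have "isCont (\<lambda>v::'u. \<delta> (norm v)) (u s)"
        using continuous_on_class_K_norm[OF \<delta>_K, where 'a = 'u] by (simp add: continuous_on_eq_continuous_at)
      ultimately have "isCont d s" unfolding d_def by (rule isCont_o2)
      then show ?thesis unfolding g_def by (intro continuous_intros)
    qed
    show "q s \<le> c + integral {t0..s} (\<lambda>r. g r * q r)" if s: "s \<in> {t0..t}" for s
    proof -
      let ?f = "\<lambda>r. W s r (\<Psi> r (x r) (u r))" and ?E = "exp (w * (s - t0))" and ?T = "exp (w * (t - t0))"
      have f: "(?f has_integral (x s - W s t0 x0)) {t0..s}"
        using x s by (auto simp: mild_solution_on_def)
      have h: "((\<lambda>r. inverse ?E * (k * C * ?T * norm (u r) + g r * q r)) has_integral
           inverse ?E * (k * C * ?T * integral {t0..s} (\<lambda>r. norm (u r)) + integral {t0..s} (\<lambda>r. g r * q r))) {t0..s}"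
        using s by (intro has_integral_mult_right has_integral_add integrable_integral u_int gq_int) auto
      have "norm (integral {t0..s} ?f) \<le> integral {t0..s} (\<lambda>r. inverse ?E * (k * C * ?T * norm (u r) + g r * q r))"
      proof (rule integral_norm_bound_integral)
        fix r assume r: "r \<in> {t0..s}"
        have "norm (?f r) \<le> k * exp (- w * (s - r)) * norm (\<Psi> r (x r) (u r))"
          using r t0 by (intro norm_W_apply_exp) auto
        also have "\<dots> \<le> k * exp (- w * (s - r)) * (C * norm (u r) + \<gamma> * norm (x r) * \<delta> (norm (u r)))"
          using r t0 k_pos by (intro mult_left_mono growth) auto
        \<comment> \<open>The kernel decay splits into a factor in \<open>s\<close>, which leaves
          the integral, and a factor in \<open>r\<close>, which turns \<open>norm (x r)\<close> into
          \<open>q r\<close>.\<close>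
        also have "exp (- w * (s - r)) = inverse ?E * exp (w * (r - t0))"
          by (simp add: exp_minus[symmetric] exp_add[symmetric] algebra_simps)
        also have "k * (inverse ?E * exp (w * (r - t0))) * (C * norm (u r) + \<gamma> * norm (x r) * \<delta> (norm (u r)))
           = inverse ?E * (k * C * exp (w * (r - t0)) * norm (u r) + g r * q r)"
          by (simp add: g_def q_def d_def algebra_simps)
        also have "\<dots> \<le> inverse ?E * (k * C * ?T * norm (u r) + g r * q r)"
          using k_pos C_pos w_pos r s by (intro mult_left_mono add_right_mono mult_right_mono) auto
        finally show "norm (?f r) \<le> inverse ?E * (k * C * ?T * norm (u r) + g r * q r)" .
      qed (use f h in auto)
      also have "\<dots> = inverse ?E * (k * C * ?T * integral {t0..s} (\<lambda>r. norm (u r)) + integral {t0..s} (\<lambda>r. g r * q r))"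
        using h by (rule integral_unique)
      finally have "norm (x s - W s t0 x0) \<le> inverse ?E * (k * C * ?T * integral {t0..s} (\<lambda>r. norm (u r)) + integral {t0..s} (\<lambda>r. g r * q r))"
        using integral_unique[OF f] by simp
      moreover have "norm (W s t0 x0) \<le> inverse ?E * (k * norm x0)"
        using norm_W_apply_exp[of t0 s x0] s t0 by (simp add: exp_minus mult_ac)
      ultimately have "norm (x s) \<le> inverse ?E * (k * norm x0 + (k * C * ?T * integral {t0..s} (\<lambda>r. norm (u r)) + integral {t0..s} (\<lambda>r. g r * q r)))"
        using norm_triangle_ineq[of "W s t0 x0" "x s - W s t0 x0"] by (simp add: distrib_left)
      then have "q s \<le> k * norm x0 + k * C * ?T * integral {t0..s} (\<lambda>r. norm (u r)) + integral {t0..s} (\<lambda>r. g r * q r)"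
        by (simp add: q_def field_simps)
      also have "integral {t0..s} (\<lambda>r. norm (u r)) \<le> integral {t0..t} (\<lambda>r. norm (u r))"
        using s by (intro integral_subset_le u_int) auto
      finally show ?thesis using k_pos C_pos by (simp add: c_def)
    qed
  qed
  moreover have "integral {t0..t} g \<le> k * \<gamma> * I"
  proof -
    have "integral {t0..t} d \<le> I" unfolding I_def total_input_def
      by (rule integral_le[OF d_int])
         (use u_int[of t] d_int in \<open>auto simp: d_def intro: integrable_add\<close>)
    then show ?thesis using k_pos \<gamma>_pos by (simp add: g_def)
  qed
  moreover have uI: "integral {t0..t} (\<lambda>s. norm (u s)) \<le> I" unfolding I_def total_input_def
  proof (rule integral_le)
    show "(\<lambda>s. norm (u s) + \<delta> (norm (u s))) integrable_on {t0..t}"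
      using integrable_add[OF u_int[of t] d_int] by (simp add: d_def)
  qed (use u_int[of t] d_nn in \<open>auto simp: d_def\<close>)
  moreover have "c \<ge> 0"
    using k_pos C_pos integral_nonneg[OF u_int[of t]] by (simp add: c_def)
  ultimately have "q t \<le> c * exp (k * \<gamma> * I)"
    by (meson exp_le_cancel_iff mult_left_mono order_trans)
  then have "exp (- w * (t - t0)) * q t \<le> exp (- w * (t - t0)) * (c * exp (k * \<gamma> * I))"
    by (rule mult_left_mono) simp
  moreover have EE: "exp (- w * (t - t0)) * exp (w * (t - t0)) = 1"
    by (simp flip: exp_add)
  moreover from EE have "exp (- w * (t - t0)) * q t = norm (x t)"
    by (simp add: q_def flip: mult.assoc)
  ultimately have "norm (x t) \<le> (exp (- w * (t - t0)) * c) * exp (k * \<gamma> * I)"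
    by (simp only: mult.assoc)
  also have "exp (- w * (t - t0)) * c = k * exp (- w * (t - t0)) * norm x0 + k * C * integral {t0..t} (\<lambda>s. norm (u s))"
    using EE unfolding c_def by algebra
  also have "\<dots> * exp (k * \<gamma> * I) \<le> (k * exp (- w * (t - t0)) * norm x0 + k * C * I) * exp (k * \<gamma> * I)"
    using uI k_pos C_pos by (intro mult_right_mono add_left_mono mult_left_mono) auto
  finally show ?thesis by (simp add: I_def)
qed

text \<open>With \<open>a\<close> the decaying initial term, \<open>I\<close> the input integral and
  \<open>b = exp (k \<gamma> I) - 1\<close>, the bound reads \<open>(a + k C I) (b + 1)\<close>,
  whose only mixed term is \<open>a b\<close>. Then \<open>\<beta>\<close> is \<open>a + a^2\<close>
  and \<open>\<alpha>\<close> is \<open>k C I (b + 1) + b^2\<close>. Subtracting 1 from the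
  exponential is what makes \<open>\<alpha> 0 = 0\<close>.\<close>

lemma iISS_system: "iISS W \<Psi>"
proof -
  define \<beta> where "\<beta> = (\<lambda>r t. k * exp (- w * t) * r + (k * exp (- w * t) * r)\<^sup>2)"
  define \<alpha> where "\<alpha> = (\<lambda>s. k * C * s * exp (k * \<gamma> * s) + (exp (k * \<gamma> * s) - 1)\<^sup>2)"
  define \<mu> where "\<mu> = (\<lambda>r. r + \<delta> r)"
  have kC: "k * C > 0" "k * \<gamma> > 0" using k_pos C_pos \<gamma>_pos by auto
  have "class_K \<mu>"
    using \<delta>_K unfolding class_K_def \<mu>_def
    by (auto intro!: continuous_intros simp: strict_mono_on_def add_strict_mono)
  moreover have "class_Kinf \<alpha>"
    unfolding class_Kinf_def class_K_def
  proof (intro conjI)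
    show "continuous_on {0..} \<alpha>" unfolding \<alpha>_def by (intro continuous_intros)
    show "\<alpha> 0 = 0" by (simp add: \<alpha>_def)
    show "strict_mono_on {0..} \<alpha>"
    proof (rule strict_mono_onI)
      fix r s :: real assume rs: "r \<in> {0..}" "s \<in> {0..}" "r < s"
      have e: "exp (k * \<gamma> * r) \<le> exp (k * \<gamma> * s)"
        using mult_left_mono[of r s "k * \<gamma>"] kC rs by simp
      have "k * C * r * exp (k * \<gamma> * r) \<le> k * C * r * exp (k * \<gamma> * s)"
        using k_pos C_pos rs e by (intro mult_left_mono mult_nonneg_nonneg) auto
      also have "\<dots> < k * C * s * exp (k * \<gamma> * s)"
        using mult_strict_left_mono[OF rs(3) kC(1)] by (intro mult_strict_right_mono) auto
      finally have "k * C * r * exp (k * \<gamma> * r) < k * C * s * exp (k * \<gamma> * s)" .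
      moreover have "(exp (k * \<gamma> * r) - 1)\<^sup>2 \<le> (exp (k * \<gamma> * s) - 1)\<^sup>2"
        using e kC rs by (intro power_mono) auto
      ultimately show "\<alpha> r < \<alpha> s" unfolding \<alpha>_def by linarith
    qed
    have "filterlim (\<lambda>s. k * C * s) at_top at_top"
      using kC by (intro filterlim_tendsto_pos_mult_at_top[OF tendsto_const]) (auto intro: filterlim_ident)
    moreover have "\<forall>\<^sub>F s in at_top. k * C * s \<le> \<alpha> s"
      using eventually_ge_at_top[of 0]
    proof eventually_elim
      case (elim s)
      have "k * C * s * 1 \<le> k * C * s * exp (k * \<gamma> * s)"
        using elim kC by (intro mult_left_mono) auto
      then show ?case unfolding \<alpha>_def by (simp add: add_increasing2)
    qed
    ultimately show "filterlim \<alpha> at_top at_top" by (rule filterlim_at_top_mono)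
  qed
  moreover have "class_KL \<beta>"
    unfolding class_KL_def
  proof (intro conjI allI impI)
    show "continuous_on ({0..} \<times> {0..}) (\<lambda>(r, t). \<beta> r t)"
      unfolding \<beta>_def case_prod_unfold by (intro continuous_intros)
    show "class_K (\<lambda>r. \<beta> r t)" for t
      unfolding class_K_def \<beta>_def
    proof (intro conjI continuous_intros)
      show "strict_mono_on {0..} (\<lambda>r. k * exp (- w * t) * r + (k * exp (- w * t) * r)\<^sup>2)"
      proof (rule strict_mono_onI)
        fix r s :: real assume rs: "r \<in> {0..}" "s \<in> {0..}" "r < s"
        have "k * exp (- w * t) * r < k * exp (- w * t) * s" using k_pos rs by simp
        moreover have "(k * exp (- w * t) * r)\<^sup>2 \<le> (k * exp (- w * t) * s)\<^sup>2"
          using k_pos rs by (intro power_mono) auto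
        ultimately show "k * exp (- w * t) * r + (k * exp (- w * t) * r)\<^sup>2
                       < k * exp (- w * t) * s + (k * exp (- w * t) * s)\<^sup>2" by linarith
      qed
    qed auto
    show "antimono_on {0..} (\<beta> r)" if "0 \<le> r" for r
    proof (rule monotone_onI)
      fix s t :: real assume "s \<le> t"
      then have "k * exp (- w * t) * r \<le> k * exp (- w * s) * r"
        using that k_pos w_pos by (intro mult_right_mono mult_left_mono) auto
      moreover from this have "(k * exp (- w * t) * r)\<^sup>2 \<le> (k * exp (- w * s) * r)\<^sup>2"
        using k_pos that by (intro power_mono) auto
      ultimately show "\<beta> r t \<le> \<beta> r s" unfolding \<beta>_def by linarith
    qed
    show "(\<beta> r \<longlongrightarrow> 0) at_top" for r
    proof -
      have "((\<lambda>t. exp (- w * t)) \<longlongrightarrow> 0) at_top"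
        using w_pos by real_asymp
      then have "((\<lambda>t. k * exp (- w * t) * r + (k * exp (- w * t) * r)\<^sup>2) \<longlongrightarrow> k * 0 * r + (k * 0 * r)\<^sup>2) at_top"
        by (intro tendsto_intros)
      then show ?thesis by (simp add: \<beta>_def)
    qed
  qed
  moreover have "norm (x t) \<le> \<beta> (norm x0) (t - t0) + \<alpha> (integral {t0..t} (\<lambda>s. \<mu> (norm (u s))))"
    if "0 \<le> t0" "u \<in> PC" "mild_solution_on W \<Psi> t0 x0 u {t0..} x" "t0 \<le> t" for t0 x0 u x t
  proof -
    define a b where "a = k * exp (- w * (t - t0)) * norm x0" and "b = exp (k * \<gamma> * total_input u t0 t) - 1"
    have "norm (x t) \<le> (a + k * C * total_input u t0 t) * (b + 1)"
      using mild_solution_bound[OF that] by (simp add: a_def b_def)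
    moreover have "2 * (a * b) \<le> a\<^sup>2 + b\<^sup>2"
      using sum_squares_bound[of a b] by simp
    moreover have "0 \<le> a\<^sup>2 + b\<^sup>2" by simp
    ultimately have "norm (x t) \<le> a + a\<^sup>2 + (k * C * total_input u t0 t * (b + 1) + b\<^sup>2)"
      by (simp only: distrib_left distrib_right mult_1_right)
    then show ?thesis
      by (simp add: \<alpha>_def \<beta>_def a_def b_def total_input_def \<mu>_def)
  qed
  moreover have "forward_complete W \<Psi>"
    unfolding forward_complete_def using exists_mild_solution by blast
  ultimately show ?thesis
    unfolding iISS_def by blast
qed

end

section \<open>The Lyapunov functional\<close>

text \<open>The logarithm lies below its tangent at \<open>x\<close>. Only this direction is needed
  for an upper Dini derivative, so difference quotients of \<open>V\<close> need not
  converge.\<close>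

lemma ln_diff_le_div:
  fixes x y :: real
  assumes "0 < x" "0 < y"
  shows "ln y - ln x \<le> (y - x) / x"
  using ln_le_minus_one[of "y / x"] assms by (simp add: ln_div diff_divide_distrib)

lemma class_Kinf_ln_quadratic:
  assumes "c > 0"
  shows "class_Kinf (\<lambda>r. ln (1 + c * r\<^sup>2))"
  unfolding class_Kinf_def class_K_def
proof (intro conjI)
  have "1 + c * r\<^sup>2 > 0" for r using assms by (simp add: add_pos_nonneg)
  then show "continuous_on {0..} (\<lambda>r. ln (1 + c * r\<^sup>2))"
    by (intro continuous_intros) (simp add: less_imp_neq[symmetric])
  show "strict_mono_on {0..} (\<lambda>r. ln (1 + c * r\<^sup>2))"
  proof (rule strict_mono_onI)
    fix r s :: real assume "r \<in> {0..}" "r < s"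
    then have "r\<^sup>2 < s\<^sup>2" by (simp add: power_strict_mono)
    then have "1 + c * r\<^sup>2 < 1 + c * s\<^sup>2" using assms by simp
    with \<open>\<And>r. 1 + c * r\<^sup>2 > 0\<close>[of r] show "ln (1 + c * r\<^sup>2) < ln (1 + c * s\<^sup>2)"
      by (intro ln_less_cancel_iff[THEN iffD2]) linarith+
  qed
  show "filterlim (\<lambda>r. ln (1 + c * r\<^sup>2)) at_top at_top"
    using assms by real_asymp
qed auto

section \<open>The integral functional: bounds, perturbation, continuity\<close>

context stable_evolution
begin

definition V :: "real \<Rightarrow> 'x \<Rightarrow> real" where
  "V t x = integral {t..} (\<lambda>\<tau>. (norm (W \<tau> t x))\<^sup>2)"

lemma norm_W_apply_sq:
  assumes "0 \<le> s" "s \<le> t"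
  shows "(norm (W t s x))\<^sup>2 \<le> k\<^sup>2 * (norm x)\<^sup>2 * exp (- (2 * w) * (t - s))"
proof -
  have "(norm (W t s x))\<^sup>2 \<le> (k * exp (- w * (t - s)) * norm x)\<^sup>2"
    by (intro power_mono norm_W_apply_exp assms) auto
  also have "(exp (- w * (t - s)))\<^sup>2 = exp (- (2 * w) * (t - s))"
    by (simp add: power2_eq_square algebra_simps flip: exp_add)
  then have "(k * exp (- w * (t - s)) * norm x)\<^sup>2 = k\<^sup>2 * (norm x)\<^sup>2 * exp (- (2 * w) * (t - s))"
    by (simp add: power_mult_distrib)
  finally show ?thesis .
qed

lemma V_integrable: "0 \<le> t \<Longrightarrow> (\<lambda>\<tau>. (norm (W \<tau> t x))\<^sup>2) integrable_on {t..}"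
  and V_le: "0 \<le> t \<Longrightarrow> V t x \<le> k\<^sup>2 / (2 * w) * (norm x)\<^sup>2"
proof -
  assume t: "0 \<le> t"
  have c: "2 * w > 0" using w_pos by simp
  have cont: "continuous_on {t..} (\<lambda>\<tau>. (norm (W \<tau> t x))\<^sup>2)"
    using t by (intro continuous_intros continuous_on_W)
  have le: "\<bar>(norm (W s t x))\<^sup>2\<bar> \<le> k\<^sup>2 * (norm x)\<^sup>2 * exp (- (2 * w) * (s - t))" if "s \<ge> t" for s
    using norm_W_apply_sq[OF t that] by simp
  show "(\<lambda>\<tau>. (norm (W \<tau> t x))\<^sup>2) integrable_on {t..}"
    by (rule exp_dominated_has_bounded_integral(1)[OF c cont le])
  show "V t x \<le> k\<^sup>2 / (2 * w) * (norm x)\<^sup>2"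
    using exp_dominated_has_bounded_integral(2)[OF c cont le] by (simp add: V_def)
qed

lemma V_nonneg: "0 \<le> t \<Longrightarrow> 0 \<le> V t x"
  unfolding V_def by (intro integral_nonneg V_integrable) auto

lemma V_zero: "V t 0 = 0"
  by (simp add: V_def)

text \<open>Since \<open>W \<tau> (t + h)\<close> applied to \<open>W (t + h) t x\<close> is
  \<open>W \<tau> t x\<close>, the unperturbed part is the tail of the integral defining
  \<open>V t x\<close>. Expanding the square leaves a cross term and a square in \<open>y\<close>,
  both integrable against the exponential decay from time \<open>t + h\<close>.\<close>

lemma V_perturbed:
  assumes t: "0 \<le> t" and h: "0 \<le> h"
  shows "V (t + h) (W (t + h) t x + y) \<le> V t x - integral {t..t+h} (\<lambda>\<tau>. (norm (W \<tau> t x))\<^sup>2)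
           + (2 * k\<^sup>2 * norm x * norm y + k\<^sup>2 * (norm y)\<^sup>2) / (2 * w)"
proof -
  let ?f = "\<lambda>\<tau>. (norm (W \<tau> t x))\<^sup>2" and ?K = "2 * k\<^sup>2 * norm x * norm y + k\<^sup>2 * (norm y)\<^sup>2"
  have th: "0 \<le> t + h" using t h by simp
  have f: "?f integrable_on {t..}" using t by (rule V_integrable)
  have f1: "?f integrable_on {t..t+h}"
    using t by (intro integrable_continuous_interval continuous_intros continuous_on_subset[OF continuous_on_W]) auto
  have f2: "?f integrable_on {t+h..}"
  proof -
    have "0 < 2 * w" using w_pos by simp
    moreover have "continuous_on {t+h..} ?f"
      using t h by (intro continuous_intros continuous_on_subset[OF continuous_on_W]) auto
    moreover have "\<bar>?f s\<bar> \<le> k\<^sup>2 * (norm (W (t+h) t x))\<^sup>2 * exp (- (2 * w) * (s - (t + h)))" if "s \<ge> t + h" for s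
      using norm_W_apply_sq[OF th that, of "W (t+h) t x"] that t h by (simp add: W_comp)
    ultimately show ?thesis by (rule exp_dominated_has_bounded_integral(1))
  qed
  have "(?f has_integral integral {t..t+h} ?f + integral {t+h..} ?f) ({t..t+h} \<union> {t+h..})"
  proof (rule has_integral_Un[OF integrable_integral[OF f1] integrable_integral[OF f2]])
    have "{t..t+h} \<inter> {t+h..} = {t+h}" using h by auto
    then show "negligible ({t..t+h} \<inter> {t+h..})" by simp
  qed
  moreover have "{t..t+h} \<union> {t+h..} = {t..}" using h by auto
  ultimately have split: "integral {t+h..} ?f = V t x - integral {t..t+h} ?f"
    by (simp add: V_def integral_unique)
  have tail: "((\<lambda>\<tau>. ?K * exp (- (2 * w) * (\<tau> - (t + h)))) has_integral ?K / (2 * w)) {t+h..}"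
    using w_pos by (intro exp_has_integral_atLeast) auto
  have "V (t + h) (W (t + h) t x + y) \<le> integral {t+h..} (\<lambda>\<tau>. ?f \<tau> + ?K * exp (- (2 * w) * (\<tau> - (t + h))))"
    unfolding V_def
  proof (intro integral_le V_integrable th integrable_add f2 has_integral_integrable[OF tail])
    fix \<tau> assume \<tau>: "\<tau> \<in> {t+h..}"
    define E where "E = exp (- w * (\<tau> - (t + h)))"
    have E: "E > 0" "exp (- (2 * w) * (\<tau> - (t + h))) = E * E"
      by (simp_all add: E_def algebra_simps flip: exp_add)
    \<comment> \<open>The decay over \<open>[t, t + h]\<close> is given away so that both factors
      carry the same \<open>E\<close>, whose square is the majorant.\<close>
    have a: "norm (W \<tau> t x) \<le> k * E * norm x"
    proof -
      have "norm (W \<tau> t x) \<le> k * exp (- w * (\<tau> - t)) * norm x"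
        using \<tau> t h by (intro norm_W_apply_exp) auto
      also have "\<dots> \<le> k * E * norm x"
        unfolding E_def using h w_pos k_pos by (intro mult_right_mono mult_left_mono) auto
      finally show ?thesis .
    qed
    have b: "norm (W \<tau> (t + h) y) \<le> k * E * norm y"
      unfolding E_def using \<tau> th by (intro norm_W_apply_exp) auto
    have "norm (W \<tau> (t + h) (W (t + h) t x + y)) \<le> norm (W \<tau> t x) + norm (W \<tau> (t + h) y)"
      using \<tau> t h by (simp add: blinfun.add_right W_comp norm_triangle_ineq)
    then have "(norm (W \<tau> (t + h) (W (t + h) t x + y)))\<^sup>2 \<le> (norm (W \<tau> t x) + norm (W \<tau> (t + h) y))\<^sup>2"
      by (intro power_mono) auto
    also have "\<dots> = ?f \<tau> + 2 * (norm (W \<tau> t x) * norm (W \<tau> (t + h) y)) + (norm (W \<tau> (t + h) y))\<^sup>2"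
      by (simp add: power2_sum)
    also have "\<dots> \<le> ?f \<tau> + 2 * ((k * E * norm x) * (k * E * norm y)) + (k * E * norm y)\<^sup>2"
      using a b E k_pos by (intro add_mono mult_left_mono mult_mono power_mono) auto
    also have "\<dots> = ?f \<tau> + ?K * exp (- (2 * w) * (\<tau> - (t + h)))"
      unfolding E(2) by (simp add: algebra_simps power2_eq_square)
    finally show "(norm (W \<tau> (t + h) (W (t + h) t x + y)))\<^sup>2 \<le> ?f \<tau> + ?K * exp (- (2 * w) * (\<tau> - (t + h)))" .
  qed
  also have "\<dots> = integral {t+h..} ?f + ?K / (2 * w)"
    using integral_add[OF f2 has_integral_integrable[OF tail]] integral_unique[OF tail] by simp
  finally show ?thesis using split by simp
qed

text \<open>Dominated convergence along sequences. The domain \<open>{t..}\<close> moves with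
  \<open>t\<close>, so the integrands are extended by zero to a common half-line.\<close>

lemma continuous_on_V: "continuous_on ({0..} \<times> UNIV) (\<lambda>(t, x). V t x)"
  unfolding continuous_on_sequentially
proof (intro allI impI ballI, elim conjE)
  fix Z :: "nat \<Rightarrow> real \<times> 'x" and z
  assume z: "z \<in> {0..} \<times> UNIV" and Z: "\<forall>n. Z n \<in> {0..} \<times> UNIV" "Z \<longlonglongrightarrow> z"
  define T X t x where "T = (\<lambda>n. fst (Z n))" "X = (\<lambda>n. snd (Z n))" "t = fst z" "x = snd z"
  note defs = this
  have T: "T \<longlonglongrightarrow> t" "\<And>n. T n \<ge> 0" and X: "X \<longlonglongrightarrow> x" and t: "t \<ge> 0"
    using Z z tendsto_fst[OF Z(2)] tendsto_snd[OF Z(2)] by (auto simp: defs mem_Times_iff)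
  obtain R where R: "\<And>n. \<bar>T n\<bar> \<le> R" 
    using Bseq_eq_bounded convergent_imp_Bseq[of T] T(1) unfolding Bseq_def convergent_def by (auto simp: real_norm_def)
  obtain Q where Q: "\<And>n. norm (X n) \<le> Q"
    using convergent_imp_Bseq[of X] X unfolding Bseq_def convergent_def by auto
  define f where "f = (\<lambda>s y \<tau>. if \<tau> \<in> {s..} then (norm (W \<tau> s y))\<^sup>2 else 0)"
  \<comment> \<open>At \<open>\<tau> = t\<close> the extended integrands may fail to converge,
    because \<open>T n\<close> can lie on either side of \<open>t\<close>; this one point is
    removed.\<close>
  define S where "S = {0..} - {t}"
  have S_eq: "(g has_integral i) S \<longleftrightarrow> (g has_integral i) {0..}" for g :: "real \<Rightarrow> real" and i
    by (rule has_integral_spike_set_eq) (auto simp: S_def intro: negligible_subset[of "{t}"])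
  have f: "(f s y has_integral V s y) S" if "s \<ge> 0" for s y
  proof -
    have "((\<lambda>\<tau>. (norm (W \<tau> s y))\<^sup>2) has_integral V s y) {s..}"
      using integrable_integral[OF V_integrable[OF that]] by (simp add: V_def)
    then have "(f s y has_integral V s y) {0..}"
      unfolding f_def using that by (subst has_integral_restrict) auto
    then show ?thesis by (simp add: S_eq)
  qed
  \<comment> \<open>The decay starts at \<open>T n\<close>, the majorant at 0; as
    \<open>T n \<le> R\<close>, the shift costs at most \<open>exp (2 w R)\<close>.\<close>
  define K where "K = k\<^sup>2 * Q\<^sup>2 * exp (2 * w * R)"
  have "(\<lambda>n. integral S (f (T n) (X n))) \<longlonglongrightarrow> integral S (f t x)"
  proof (rule dominated_convergence(2))
    show "f (T n) (X n) integrable_on S" for n using f[OF T(2)] by blast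
    have "((\<lambda>\<tau>. K * exp (- (2 * w) * (\<tau> - 0))) has_integral K / (2 * w)) {0..}"
      using w_pos by (intro exp_has_integral_atLeast) auto
    then have "((\<lambda>\<tau>. K * exp (- (2 * w) * (\<tau> - 0))) has_integral K / (2 * w)) S"
      by (simp add: S_eq)
    then show "(\<lambda>\<tau>. K * exp (- (2 * w) * (\<tau> - 0))) integrable_on S" by blast
    show "norm (f (T n) (X n) \<tau>) \<le> K * exp (- (2 * w) * (\<tau> - 0))" if "\<tau> \<in> S" for n \<tau>
    proof (cases "T n \<le> \<tau>")
      case True
      have "(norm (W \<tau> (T n) (X n)))\<^sup>2 \<le> k\<^sup>2 * (norm (X n))\<^sup>2 * exp (- (2 * w) * (\<tau> - T n))"
        using True T by (intro norm_W_apply_sq) auto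
      also have "\<dots> \<le> k\<^sup>2 * Q\<^sup>2 * exp (2 * w * R - 2 * w * \<tau>)"
        using Q[of n] R[of n] w_pos k_pos
        by (intro mult_mono power_mono) (auto simp: algebra_simps intro!: mult_left_mono)
      also have "\<dots> = K * exp (- (2 * w) * (\<tau> - 0))"
        by (simp add: K_def exp_diff exp_minus field_simps)
      finally show ?thesis using True by (simp add: f_def)
    qed (simp add: f_def K_def)
    show "(\<lambda>n. f (T n) (X n) \<tau>) \<longlonglongrightarrow> f t x \<tau>" if "\<tau> \<in> S" for \<tau>
    proof (cases "\<tau> < t")
      case True
      have "\<forall>\<^sub>F n in sequentially. T n > \<tau>" using order_tendstoD(1)[OF T(1) True] .
      then have "\<forall>\<^sub>F n in sequentially. f (T n) (X n) \<tau> = f t x \<tau>"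
        by eventually_elim (use True in \<open>auto simp: f_def\<close>)
      then show ?thesis by (rule tendsto_eventually)
    next
      case False
      then have "t < \<tau>" using that by (auto simp: S_def)
      then have ev: "\<forall>\<^sub>F n in sequentially. T n < \<tau>" using order_tendstoD(2)[OF T(1)] by blast
      have "(\<lambda>n. (norm (W \<tau> (T n) (X n)))\<^sup>2) \<longlonglongrightarrow> (norm (W \<tau> t x))\<^sup>2"
      proof (intro tendsto_power tendsto_norm W_tendsto[OF tendsto_const T(1) X t])
        show "\<forall>\<^sub>F n in sequentially. 0 \<le> T n \<and> T n \<le> \<tau>"
          using ev by eventually_elim (use T(2) in auto)
      qed (use \<open>t < \<tau>\<close> in auto)
      moreover have "\<forall>\<^sub>F n in sequentially. (norm (W \<tau> (T n) (X n)))\<^sup>2 = f (T n) (X n) \<tau>"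
        using ev by eventually_elim (auto simp: f_def)
      ultimately have "(\<lambda>n. f (T n) (X n) \<tau>) \<longlonglongrightarrow> (norm (W \<tau> t x))\<^sup>2"
        by (rule Lim_transform_eventually)
      then show ?thesis using \<open>t < \<tau>\<close> by (simp add: f_def)
    qed
  qed
  then have "(\<lambda>n. V (T n) (X n)) \<longlonglongrightarrow> V t x"
    using integral_unique[OF f] T(2) t by simp
  then show "((\<lambda>(t, x). V t x) \<circ> Z) \<longlonglongrightarrow> (\<lambda>(t, x). V t x) z"
    by (simp add: o_def case_prod_unfold defs)
qed

end

section \<open>Coercivity and dissipation along mild solutions\<close>

locale coercive_system = controlled_system W k w \<Psi> C \<gamma> \<delta>
  for W :: "real \<Rightarrow> real \<Rightarrow> ('x::banach \<Rightarrow>\<^sub>L 'x)" and k w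
    and \<Psi> :: "real \<Rightarrow> 'x \<Rightarrow> 'u::real_normed_vector \<Rightarrow> 'x" and C \<gamma> \<delta> +
  fixes M lam :: real
  assumes M_pos: "M > 0" and lam_pos: "lam > 0"
    and norm_W_ge: "\<And>s t x. 0 \<le> s \<Longrightarrow> s \<le> t \<Longrightarrow> M * exp (- lam * (t - s)) * norm x \<le> norm (W t s x)"
begin

definition c_low where "c_low = M\<^sup>2 / (2 * lam)"
definition c_up where "c_up = k\<^sup>2 / (2 * w)"

lemma c_low_pos: "c_low > 0" using M_pos lam_pos by (simp add: c_low_def)
lemma c_up_pos: "c_up > 0" using k_pos w_pos by (simp add: c_up_def)

lemma V_ge:
  assumes t: "0 \<le> t"
  shows "c_low * (norm x)\<^sup>2 \<le> V t x"
proof -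
  have int: "((\<lambda>s. (M\<^sup>2 * (norm x)\<^sup>2) * exp (- (2 * lam) * (s - t))) has_integral (M\<^sup>2 * (norm x)\<^sup>2) / (2 * lam)) {t..}"
    using lam_pos by (intro exp_has_integral_atLeast) auto
  have "(M\<^sup>2 * (norm x)\<^sup>2) / (2 * lam) \<le> V t x"
    unfolding V_def
  proof (rule has_integral_le[OF int integrable_integral[OF V_integrable[OF t]]])
    fix s assume s: "s \<in> {t..}"
    have "(M * exp (- lam * (s - t)) * norm x)\<^sup>2 \<le> (norm (W s t x))\<^sup>2"
      using s t M_pos by (intro power_mono norm_W_ge) auto
    moreover have "(exp (- lam * (s - t)))\<^sup>2 = exp (- (2 * lam) * (s - t))"
      by (simp add: power2_eq_square algebra_simps flip: exp_add)
    ultimately show "(M\<^sup>2 * (norm x)\<^sup>2) * exp (- (2 * lam) * (s - t)) \<le> (norm (W s t x))\<^sup>2"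
      by (simp add: power_mult_distrib mult_ac)
  qed
  then show ?thesis by (simp add: c_low_def)
qed

definition Z where "Z t x = ln (1 + V t x)"

text \<open>A lower estimate of \<open>r^2 / (1 + V)\<close> through the upper bound on
  \<open>V\<close>. It tends to \<open>1 / c_up\<close> as \<open>r\<close> grows, so it is positive
  definite but not of class K-infinity.\<close>

definition decay where "decay r = r\<^sup>2 / (1 + c_up * r\<^sup>2)"

text \<open>The factor \<open>k ^ 3 / w\<close> is \<open>2 k^2 / (2 w)\<close> from the cross term
  in \<open>V_perturbed\<close> times the \<open>k\<close> bounding the perturbation;
  \<open>1 + 1 / c_low\<close> bounds \<open>|x| / (1 + V)\<close> and
  \<open>|x|^2 / (1 + V)\<close>.\<close>

definition gain where "gain r = k ^ 3 / w * (1 + 1 / c_low) * (C * r + \<gamma> * \<delta> r)"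

text \<open>The lower bound on \<open>V\<close> gives \<open>1 + |x|^2 \<le> p (1 + V)\<close>, and
  both \<open>|x|\<close> and \<open>|x|^2\<close> are at most \<open>1 + |x|^2\<close>. Hence both
  quotients by \<open>1 + V\<close> are at most \<open>p\<close>, uniformly in
  \<open>x\<close>.\<close>

lemma dissipation_bound:
  assumes t: "0 \<le> t" and n: "0 \<le> n"
  shows "(- (norm x)\<^sup>2 + k ^ 3 / w * norm x * (C * n + \<gamma> * norm x * \<delta> n)) / (1 + V t x)
           \<le> - decay (norm x) + gain n"
proof -
  define p where "p = 1 + 1 / c_low"
  let ?r = "norm x" and ?v = "1 + V t x"
  have v: "?v \<ge> 1" using V_nonneg[OF t] by simp
  have d: "\<delta> n \<ge> 0" using class_K_nonneg[OF \<delta>_K n] .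
  have p: "1 + ?r\<^sup>2 \<le> p * ?v"
  proof -
    have "?r\<^sup>2 \<le> V t x / c_low" using V_ge[OF t, of x] c_low_pos by (simp add: field_simps)
    moreover have "p * ?v = 1 + V t x + 1 / c_low + V t x / c_low" by (simp add: p_def algebra_simps)
    moreover have "V t x \<ge> 0" "1 / c_low \<ge> 0" using V_nonneg[OF t] c_low_pos by auto
    ultimately show ?thesis by linarith
  qed
  have "2 * ?r \<le> ?r\<^sup>2 + 1" using sum_squares_bound[of ?r 1] by simp
  then have r1: "?r \<le> 1 + ?r\<^sup>2" using norm_ge_zero[of x] by linarith
  have q1: "?r / ?v \<le> p" using order_trans[OF r1 p] v by (simp add: divide_le_eq)
  have q2: "?r\<^sup>2 / ?v \<le> p" using p v by (simp add: divide_le_eq)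
  have "decay ?r \<le> ?r\<^sup>2 / ?v"
    unfolding decay_def using V_le[OF t, of x] v c_up_pos
    by (intro divide_left_mono mult_pos_pos) (auto simp: c_up_def add_pos_nonneg)
  moreover have "(k ^ 3 / w) * (C * n * (?r / ?v) + \<gamma> * \<delta> n * (?r\<^sup>2 / ?v)) \<le> (k ^ 3 / w) * (C * n * p + \<gamma> * \<delta> n * p)"
    using q1 q2 k_pos w_pos C_pos \<gamma>_pos n d by (intro mult_left_mono add_mono) auto
  moreover have "(- ?r\<^sup>2 + k ^ 3 / w * ?r * (C * n + \<gamma> * ?r * \<delta> n)) / ?v
     = - (?r\<^sup>2 / ?v) + (k ^ 3 / w) * (C * n * (?r / ?v) + \<gamma> * \<delta> n * (?r\<^sup>2 / ?v))"
    by (simp add: divide_inverse power2_eq_square algebra_simps)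
  moreover have "gain n = (k ^ 3 / w) * (C * n * p + \<gamma> * \<delta> n * p)"
    unfolding gain_def p_def[symmetric] by (simp only: distrib_left mult_ac)
  ultimately show ?thesis by linarith
qed

text \<open>For each slack \<open>\<epsilon>\<close> the growth bound along the solution stays below
  \<open>G t + \<epsilon>\<close> just after \<open>t\<close>, which bounds the perturbation
  linearly in \<open>h\<close> and the upper derivative by \<open>\<rho> \<epsilon> / V0\<close>.
  Letting \<open>\<epsilon>\<close> tend to 0 gives the claim.\<close>

lemma lie_derivative_Z:
  assumes t: "0 \<le> t" and u: "u \<in> PC"
  shows "lie_derivative_le W \<Psi> Z t x0 u (- decay (norm x0) + gain (norm (u t)))"
  unfolding lie_derivative_le_def
proof (intro allI impI)
  fix e :: real and x assume e: "e > 0" and x: "mild_solution_on W \<Psi> t x0 u {t..<t+e} x"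
  let ?L = "Limsup (at_right 0) (\<lambda>h. ereal ((Z (t + h) (x (t + h)) - Z t x0) / h))"
  have x_cont: "continuous_on {t..<t+e} x"
    and x_int: "\<And>s. s \<in> {t..<t+e} \<Longrightarrow> ((\<lambda>r. W s r (\<Psi> r (x r) (u r))) has_integral (x s - W s t x0)) {t..s}"
    using x by (auto simp: mild_solution_on_def)
  \<comment> \<open>The initial condition is hidden in the integral equation: at time
    \<open>t\<close> the integral runs over a single point and vanishes.\<close>
  have "((\<lambda>r. W t r (\<Psi> r (x r) (u r))) has_integral (x t - x0)) {t}"
    using x_int[of t] e t by simp
  then have xt: "x t = x0"
    using has_integral_unique[OF _ has_integral_refl(2)] by fastforce
  define G where "G = (\<lambda>s. C * norm (u s) + \<gamma> * norm (x s) * \<delta> (norm (u s)))"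
  \<comment> \<open>Right continuity makes the limit the value \<open>u t\<close> itself, the one
    that enters the Lyapunov inequality.\<close>
  have ut: "(u \<longlongrightarrow> u t) (at_right t)"
    using t u by (auto simp: PC_def continuous_within)
  have "(x \<longlongrightarrow> x t) (at_right t)"
  proof -
    have "(x \<longlongrightarrow> x t) (at t within {t..<t+e})"
      using x_cont e by (auto simp: continuous_on_def)
    moreover have "at t within {t..<t+e} = at_right t"
      using e by (intro at_within_nhd[of _ "{..<t+e}"]) auto
    ultimately show ?thesis by simp
  qed
  then have G_lim: "(G \<longlongrightarrow> G t) (at_right t)"
    unfolding G_def using ut continuous_on_class_K_norm[OF \<delta>_K, where 'a = 'u]
    by (intro tendsto_intros continuous_on_tendsto_compose[of UNIV "\<lambda>v. \<delta> (norm v)" u]) auto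
  have G_nn: "G t \<ge> 0"
    unfolding G_def using C_pos \<gamma>_pos class_K_nonneg[OF \<delta>_K, of "norm (u t)"] by auto
  define V0 where "V0 = 1 + V t x0"
  have V0: "V0 \<ge> 1" using V_nonneg[OF t] by (simp add: V0_def)
  define \<rho> where "\<rho> = (\<lambda>\<epsilon>. - ((norm x0)\<^sup>2 - \<epsilon>) + (2 * k\<^sup>2 * norm x0 * (k * (G t + \<epsilon>)) + k\<^sup>2 * (\<epsilon> * (k * (G t + \<epsilon>))\<^sup>2)) / (2 * w))"
  have bound: "?L \<le> ereal (\<rho> \<epsilon> / V0)" if \<epsilon>: "\<epsilon> > 0" for \<epsilon>
  proof (rule Limsup_bounded)
    have "\<forall>\<^sub>F s in at_right t. G s < G t + \<epsilon>"
      using order_tendstoD(2)[OF G_lim, of "G t + \<epsilon>"] \<epsilon> by simp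
    then obtain d1 where d1: "d1 > t" "\<And>s. t < s \<Longrightarrow> s < d1 \<Longrightarrow> G s < G t + \<epsilon>"
      unfolding eventually_at_right_field by blast
    have "((\<lambda>s. (norm (W s t x0))\<^sup>2) \<longlongrightarrow> (norm (W t t x0))\<^sup>2) (at_right t)"
      using t by (intro tendsto_power tendsto_norm W_tendsto tendsto_ident_at tendsto_const) (auto simp: eventually_at_filter)
    then have "\<forall>\<^sub>F s in at_right t. (norm (W s t x0))\<^sup>2 > (norm x0)\<^sup>2 - \<epsilon>"
      using \<epsilon> t by (intro order_tendstoD(1)) auto
    then obtain d2 where d2: "d2 > t" "\<And>s. t < s \<Longrightarrow> s < d2 \<Longrightarrow> (norm x0)\<^sup>2 - \<epsilon> < (norm (W s t x0))\<^sup>2"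
      unfolding eventually_at_right_field by blast
    \<comment> \<open>The bound \<open>d \<le> \<epsilon>\<close> disposes of the quadratic term: in
      \<open>(norm y)^2\<close>, of order \<open>h^2\<close>, one factor \<open>h\<close> is
      replaced by \<open>\<epsilon>\<close>, which leaves a multiple of \<open>h\<close> that
      vanishes with \<open>\<epsilon>\<close> after division.\<close>
    define d where "d = Min {d1 - t, d2 - t, e, \<epsilon>}"
    have d: "d > 0" "d \<le> d1 - t" "d \<le> d2 - t" "d \<le> e" "d \<le> \<epsilon>"
      using d1 d2 e \<epsilon> by (auto simp: d_def)
    have "\<forall>\<^sub>F h in at_right 0. 0 < h \<and> h < d"
      using d(1) by (auto simp: eventually_at_right_field)
    then show "\<forall>\<^sub>F h in at_right 0. ereal ((Z (t + h) (x (t + h)) - Z t x0) / h) \<le> ereal (\<rho> \<epsilon> / V0)"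
    proof eventually_elim
      case (elim h)
      then have h: "h > 0" "h < d" by auto
      define y where "y = x (t + h) - W (t + h) t x0"
      have y: "norm y \<le> h * (k * (G t + \<epsilon>))"
      proof -
        have I: "((\<lambda>r. W (t+h) r (\<Psi> r (x r) (u r))) has_integral y) {t..t+h}"
          unfolding y_def using h d by (intro x_int) auto
        have "norm (integral {t..t+h} (\<lambda>r. W (t+h) r (\<Psi> r (x r) (u r)))) \<le> integral {t..t+h} (\<lambda>r. k * (G t + \<epsilon>))"
        proof (rule integral_norm_bound_integral)
          fix r assume r: "r \<in> {t..t+h}"
          have "norm (W (t+h) r (\<Psi> r (x r) (u r))) \<le> k * norm (\<Psi> r (x r) (u r))"
            using r t by (intro norm_W_apply) auto
          also have "\<dots> \<le> k * G r"
            unfolding G_def using r t k_pos by (intro mult_left_mono growth) auto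
          also have "G r \<le> G t + \<epsilon>"
            using r h d \<epsilon> d1(2)[of r] by (cases "r = t") auto
          finally show "norm (W (t+h) r (\<Psi> r (x r) (u r))) \<le> k * (G t + \<epsilon>)"
            using k_pos by simp
        qed (use I in auto)
        then show ?thesis using integral_unique[OF I] h by (simp add: mult_ac)
      qed
      have f: "h * ((norm x0)\<^sup>2 - \<epsilon>) \<le> integral {t..t+h} (\<lambda>\<tau>. (norm (W \<tau> t x0))\<^sup>2)"
      proof -
        have "integral {t..t+h} (\<lambda>_. (norm x0)\<^sup>2 - \<epsilon>) \<le> integral {t..t+h} (\<lambda>\<tau>. (norm (W \<tau> t x0))\<^sup>2)"
        proof (rule integral_le)
          show "(\<lambda>\<tau>. (norm (W \<tau> t x0))\<^sup>2) integrable_on {t..t+h}"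
            using t by (intro integrable_continuous_interval continuous_intros continuous_on_subset[OF continuous_on_W]) auto
          show "(norm x0)\<^sup>2 - \<epsilon> \<le> (norm (W s t x0))\<^sup>2" if "s \<in> {t..t+h}" for s
            using that h d \<epsilon> t d2(2)[of s] by (cases "s = t") auto
        qed auto
        then show ?thesis using h by simp
      qed
      have "V (t + h) (x (t + h)) - V t x0 \<le> - integral {t..t+h} (\<lambda>\<tau>. (norm (W \<tau> t x0))\<^sup>2)
           + (2 * k\<^sup>2 * norm x0 * norm y + k\<^sup>2 * (norm y)\<^sup>2) / (2 * w)"
        using V_perturbed[OF t, of h x0 y] h by (simp add: y_def)
      also have "\<dots> \<le> - (h * ((norm x0)\<^sup>2 - \<epsilon>))
           + (2 * k\<^sup>2 * norm x0 * (h * (k * (G t + \<epsilon>))) + k\<^sup>2 * (h * (\<epsilon> * (k * (G t + \<epsilon>))\<^sup>2))) / (2 * w)"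
      proof -
        have "(norm y)\<^sup>2 \<le> (h * (k * (G t + \<epsilon>)))\<^sup>2" using y by (intro power_mono) auto
        also have "\<dots> = h * (h * (k * (G t + \<epsilon>))\<^sup>2)" by (simp add: power2_eq_square)
        also have "\<dots> \<le> h * (\<epsilon> * (k * (G t + \<epsilon>))\<^sup>2)"
          using h d by (intro mult_left_mono mult_right_mono) auto
        finally show ?thesis
          using f y w_pos by (intro add_mono divide_right_mono mult_left_mono) auto
      qed
      also have "\<dots> = h * \<rho> \<epsilon>"
        by (simp add: \<rho>_def algebra_simps add_divide_distrib)
      finally have VV: "V (t + h) (x (t + h)) - V t x0 \<le> h * \<rho> \<epsilon>" .
      have "Z (t + h) (x (t + h)) - Z t x0 \<le> ((1 + V (t + h) (x (t + h))) - V0) / V0"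
        unfolding Z_def V0_def using V_nonneg[of t x0] V_nonneg[of "t + h" "x (t + h)"] t h
        by (intro ln_diff_le_div) auto
      also have "\<dots> \<le> h * \<rho> \<epsilon> / V0"
        using VV V0 by (intro divide_right_mono) (auto simp: V0_def)
      finally show ?case using h by (simp add: divide_le_eq mult.commute)
    qed
  qed
  have "((\<lambda>\<epsilon>. \<rho> \<epsilon> / V0) \<longlongrightarrow> \<rho> 0 / V0) (at_right 0)"
    unfolding \<rho>_def using V0 w_pos by (intro tendsto_intros) auto
  then have "((\<lambda>\<epsilon>. ereal (\<rho> \<epsilon> / V0)) \<longlongrightarrow> ereal (\<rho> 0 / V0)) (at_right 0)"
    by (rule tendsto_ereal)
  moreover have "\<forall>\<^sub>F \<epsilon> in at_right 0. ?L \<le> ereal (\<rho> \<epsilon> / V0)"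
    using bound by (auto simp: eventually_at_filter)
  ultimately have "?L \<le> ereal (\<rho> 0 / V0)"
    by (rule tendsto_lowerbound) simp
  also have "\<rho> 0 = - (norm x0)\<^sup>2 + k ^ 3 / w * norm x0 * (C * norm (u t) + \<gamma> * norm x0 * \<delta> (norm (u t)))"
    using w_pos by (simp add: \<rho>_def G_def xt power2_eq_square power3_eq_cube)
  also have "ereal (\<dots> / V0) \<le> ereal (- decay (norm x0) + gain (norm (u t)))"
    unfolding V0_def using dissipation_bound[OF t, of "norm (u t)" x0] by simp
  finally show "?L \<le> ereal (- decay (norm x0) + gain (norm (u t)))" .
qed

lemma coercive_Z: "coercive_iISS_Lyapunov W \<Psi> Z"
  unfolding coercive_iISS_Lyapunov_def
proof (intro conjI exI allI impI ballI)
  have "continuous_on ({0..} \<times> UNIV) (\<lambda>z. ln (1 + (\<lambda>(t, x). V t x) z))"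
    by (intro continuous_intros continuous_on_V) (auto simp: add_nonneg_eq_0_iff V_nonneg)
  then show "continuous_on ({0..} \<times> UNIV) (\<lambda>(t, x). Z t x)"
    by (simp add: Z_def case_prod_unfold)
  show "Z t 0 = 0" for t by (simp add: Z_def V_zero)
  show "class_Kinf (\<lambda>r. ln (1 + c_low * r\<^sup>2))" "class_Kinf (\<lambda>r. ln (1 + c_up * r\<^sup>2))"
    by (intro class_Kinf_ln_quadratic c_low_pos c_up_pos)+
  show "pos_def decay"
    unfolding pos_def_def decay_def
  proof (intro conjI allI impI)
    have pos: "1 + c_up * r\<^sup>2 > 0" for r using c_up_pos by (simp add: add_pos_nonneg)
    then show "continuous_on {0..} (\<lambda>r. r\<^sup>2 / (1 + c_up * r\<^sup>2))"
      by (intro continuous_intros) (simp add: less_imp_neq[symmetric])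
    show "r\<^sup>2 / (1 + c_up * r\<^sup>2) > 0" if "r > 0" for r using pos that by simp
  qed simp
  show "class_K gain"
  proof -
    have "k ^ 3 / w * (1 + 1 / c_low) > 0" using k_pos w_pos c_low_pos by (simp add: add_pos_pos)
    moreover have "C * r + \<gamma> * \<delta> r < C * s + \<gamma> * \<delta> s" if "0 \<le> r" "r < s" for r s
      using that \<delta>_K C_pos \<gamma>_pos
      by (intro add_strict_mono mult_strict_left_mono) (auto simp: class_K_def strict_mono_on_def)
    ultimately have "strict_mono_on {0..} gain"
      unfolding gain_def by (intro strict_mono_onI mult_strict_left_mono) auto
    then show ?thesis
      using \<delta>_K w_pos unfolding class_K_def gain_def by (auto intro!: continuous_intros)
  qed
  fix t :: real and x :: 'x assume t: "0 \<le> t"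
  show "ln (1 + c_low * (norm x)\<^sup>2) \<le> Z t x"
    unfolding Z_def using V_ge[OF t, of x] c_low_pos V_nonneg[OF t, of x]
    by (intro ln_le_cancel_iff[THEN iffD2]) (auto simp: add_pos_nonneg)
  show "Z t x \<le> ln (1 + c_up * (norm x)\<^sup>2)"
    unfolding Z_def using V_le[OF t, of x] c_up_pos V_nonneg[OF t, of x]
    by (intro ln_le_cancel_iff[THEN iffD2]) (auto simp: add_pos_nonneg c_up_def)
  show "lie_derivative_le W \<Psi> Z t x u (- decay (norm x) + gain (norm (u t)))" if "u \<in> PC" for u
    using t that by (rule lie_derivative_Z)
qed

end

theorem mainTheorem13:
  fixes D :: "real \<Rightarrow> 'x::banach set"
    and A :: "real \<Rightarrow> 'x \<Rightarrow> 'x"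
    and W :: "real \<Rightarrow> real \<Rightarrow> ('x \<Rightarrow>\<^sub>L 'x)"
    and B :: "real \<Rightarrow> ('u::banach \<Rightarrow>\<^sub>L 'x)"
    and \<psi> :: "real \<Rightarrow> 'x \<Rightarrow> 'u \<Rightarrow> 'x"
    and \<gamma> M lam :: real and \<delta> :: "real \<Rightarrow> real"
  assumes gen: "generates_evolution D A W"
    and B_cont: "continuous_on {0..} B"
    and B_bdd: "\<exists>C. \<forall>t\<ge>0. norm (B t) \<le> C"
    and H1: "H1 (\<lambda>t x u. B t u + \<psi> t x u)"
    and \<gamma>_pos: "\<gamma> > 0" and \<delta>_K: "class_K \<delta>"
    and \<psi>_bound: "\<forall>t\<ge>0. \<forall>x v. norm (\<psi> t x v) \<le> \<gamma> * norm x * \<delta> (norm v)"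
    and stable: "unif_exp_stable W"
    and M_pos: "M > 0" and lam_pos: "lam > 0"
    and lower: "\<forall>x s t. 0 \<le> s \<and> s \<le> t \<longrightarrow> norm (W t s x) \<ge> M * exp (- lam * (t - s)) * norm x"
  shows "coercive_iISS_Lyapunov W (\<lambda>t x u. B t u + \<psi> t x u)
           (\<lambda>t x. ln (1 + integral {t..} (\<lambda>\<tau>. (norm (W \<tau> t x))\<^sup>2)))
       \<and> iISS W (\<lambda>t x u. B t u + \<psi> t x u)"
proof -
  obtain k w where kw: "k > 0" "w > 0"
    "\<And>s t. 0 \<le> s \<Longrightarrow> s \<le> t \<Longrightarrow> norm (W t s) \<le> k * exp (- w * (t - s))"
    using stable unfolding unif_exp_stable_def by blast
  obtain C0 where C0: "\<And>t. t \<ge> 0 \<Longrightarrow> norm (B t) \<le> C0" using B_bdd by blast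
  \<comment> \<open>\<open>C0\<close> need not be positive, for instance when \<open>B\<close>
    vanishes; enlarging it preserves the bound and meets \<open>C > 0\<close>.\<close>
  define C where "C = max C0 1"
  interpret coercive_system W k w "\<lambda>t x u. B t u + \<psi> t x u" C \<gamma> \<delta> M lam
  proof unfold_locales
    show "evolution_family W" using gen by (simp add: generates_evolution_def)
    show "norm (B t v + \<psi> t x v) \<le> C * norm v + \<gamma> * norm x * \<delta> (norm v)" if "0 \<le> t" for t x v
    proof -
      have "norm (B t v) \<le> norm (B t) * norm v" by (rule norm_blinfun)
      also have "\<dots> \<le> C * norm v"
        using C0[OF that] by (intro mult_right_mono) (auto simp: C_def)
      finally show ?thesis
        using \<psi>_bound that by (intro norm_triangle_le add_mono) auto
    qed
  qed (use kw H1 \<gamma>_pos \<delta>_K M_pos lam_pos lower in \<open>auto simp: C_def\<close>)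
  show ?thesis
    using coercive_Z iISS_system by (simp add: Z_def[abs_def] V_def)
qed

end
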